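(* Let $Z$ be a fake weighted projective space of dimension $n$ with $\operatorname{Cl}(Z)=\mathbb{Z}\oplus\mathbb{Z}/\mu_1\mathbb{Z}\oplus\dots\oplus\mathbb{Z}/\mu_r\mathbb{Z}$ (in invariant factor form) admitting a nef-partition $p_1\sqcup\dots\sqcup p_s=\{0,\dots,n\}$. Then $2s\le n+1$. Furthermore, a fake weighted projective space $Z$ of dimension $2s-1$, with $\operatorname{Cl}(Z)=\mathbb{Z}\oplus\mathbb{Z}/\mu_1\mathbb{Z}\oplus\dots\oplus\mathbb{Z}/\mu_r\mathbb{Z}$ in invariant factor form, admits a nef-partition into $s$ blocks if and only if $\mu_1=\dots=\mu_r=2$ and $Z$ admits a degree matrix of the form $$Q=\begin{bmatrix}\mathbf{1}_s&\mathbf{1}_s\\ A&A\end{bmatrix},\qquad \mathbf{1}_s=[1,\dots,1]\in\mathbb{Z}^{s},$$ where $A$ is an $r\times s$ matrix over $\mathbb{Z}/2\mathbb{Z}$ whose columns affinely span the whole $(\mathbb{Z}/2\mathbb{Z})^r$.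
   Context: Varieties are over a fixed algebraically closed field $\mathbb{K}$ of characteristic zero. A fake weighted projective space (fwps) of dimension $n$ is an $n$-dimensional $\mathbb{Q}$-factorial toric Fano variety $Z$ of Picard number one. Its divisor class group is presented in invariant factor form $\operatorname{Cl}(Z)=\mathbb{Z}\oplus\mathbb{Z}/\mu_1\mathbb{Z}\oplus\dots\oplus\mathbb{Z}/\mu_r\mathbb{Z}$ with $r\ge 0$, $\mu_i\ge 2$ and $\mu_r\mid\mu_{r-1}\mid\dots\mid\mu_1$. Write $\omega_i=(w_i,\eta_i)\in\operatorname{Cl}(Z)$, $i=0,\dots,n$, for the classes of the torus-invariant prime divisors, numbered so that $1\le w_0\le\dots\le w_n$. The tuple $Q=[\omega_0,\dots,\omega_n]$, written as a matrix with columns $\omega_i$, is called a degree matrix of $Z$ (it depends on the chosen numbering and on the chosen isomorphism of $\operatorname{Cl}(Z)$ with the displayed group); any $n$ of the $\omega_i$ generate $\operatorname{Cl}(Z)$ as a group, and $Z$ is the quotient of $\mathbb{K}^{n+1}\setminus\{0\}$ by the diagonal action, with weights $\omega_i$, of the quasitorus with character group $\operatorname{Cl}(Z)$. $\operatorname{Pic}(Z)\subseteq\operatorname{Cl}(Z)$ is the subgroup of Cartier divisor classes. A nef-partition of $Z$ is a partition $p_1\sqcup\dots\sqcup p_s=\{0,\dots,n\}$ into $s$ nonempty blocks such that $\omega_{p_j}:=\sum_{i\in p_j}\omega_i\in\operatorname{Pic}(Z)$ for $j=1,\dots,s$, and moreover $\omega_{p_j}\ne\omega_i$ for all $j$ and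 all $i$ (in particular no block has size one). *)

theory Defs
  imports
    "HOL-Analysis.Analysis"
    "HOL-Algebra.Free_Abelian_Groups"
    "HOL-Library.Disjoint_Sets"
begin

text \<open>
  Toric varieties are given by their fans. The lattice of one-parameter subgroups is the type
  of integer vectors over a finite index type, the fan lives in the corresponding real vector
  space, and the dimension of the variety is the cardinality of the index type. The character
  lattice is the same type, paired with the former by \<^const>\<open>scalar_product\<close>.
  None of the notions below depends on the algebraically closed ground field of
  characteristic zero, which therefore does not occur.
\<close>

section \<open>Fans\<close>

definition real_point :: "int ^ 'n \<Rightarrow> real ^ 'n" where
  "real_point v = (\<chi> i. real_of_int (v $ i))"

definition rational_polyhedral_cone :: "(real ^ 'n) set \<Rightarrow> bool" where
  "rational_polyhedral_cone \<sigma> \<longleftrightarrow>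
     (\<exists>S :: (int ^ 'n) set. finite S \<and> \<sigma> = convex_cone hull (real_point ` S))"

definition pointed_cone :: "(real ^ 'n) set \<Rightarrow> bool" where
  "pointed_cone \<sigma> \<longleftrightarrow> (\<forall>x. x \<in> \<sigma> \<and> - x \<in> \<sigma> \<longrightarrow> x = 0)"

text \<open>
  The library's \<^const>\<open>face_of\<close> admits the empty face, which is not a face of a cone in the
  sense of toric geometry.
\<close>

definition fan :: "(real ^ 'n) set set \<Rightarrow> bool" where
  "fan \<Sigma> \<longleftrightarrow>
     finite \<Sigma> \<and>
     (\<forall>\<sigma>\<in>\<Sigma>. rational_polyhedral_cone \<sigma> \<and> pointed_cone \<sigma>) \<and>
     (\<forall>\<sigma>\<in>\<Sigma>. \<forall>\<tau>. \<tau> face_of \<sigma> \<and> \<tau> \<noteq> {} \<longrightarrow> \<tau> \<in> \<Sigma>) \<and>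
     (\<forall>\<sigma>\<in>\<Sigma>. \<forall>\<tau>\<in>\<Sigma>. (\<sigma> \<inter> \<tau>) face_of \<sigma>)"

definition complete_fan :: "(real ^ 'n) set set \<Rightarrow> bool" where
  "complete_fan \<Sigma> \<longleftrightarrow> fan \<Sigma> \<and> \<Union>\<Sigma> = UNIV"

definition primitive :: "int ^ 'n \<Rightarrow> bool" where
  "primitive v \<longleftrightarrow> Gcd (range (\<lambda>i. v $ i)) = 1"

text \<open>
  The rays are represented by their primitive generators. They correspond to the
  torus-invariant prime divisors.
\<close>

definition rays :: "(real ^ 'n) set set \<Rightarrow> (int ^ 'n) set" where
  "rays \<Sigma> = {v. primitive v \<and> convex_cone hull {real_point v} \<in> \<Sigma>}"


section \<open>Divisors, class group and Picard group\<close>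

definition weil_div :: "(real ^ 'n) set set \<Rightarrow> (int ^ 'n \<Rightarrow>\<^sub>0 int) monoid" where
  "weil_div \<Sigma> = free_Abelian_group (rays \<Sigma>)"

text \<open>
  The character with exponent \<open>m\<close> vanishes to order \<open>\<langle>m, v\<rangle>\<close> along the prime divisor of the
  ray \<open>v\<close>.
\<close>

definition char_div :: "(real ^ 'n) set set \<Rightarrow> int ^ 'n \<Rightarrow> (int ^ 'n \<Rightarrow>\<^sub>0 int)" where
  "char_div \<Sigma> m = (\<Sum>v\<in>rays \<Sigma>. frag_cmul (scalar_product m v) (frag_of v))"

definition Cl :: "(real ^ 'n) set set \<Rightarrow> (int ^ 'n \<Rightarrow>\<^sub>0 int) set monoid" where
  "Cl \<Sigma> = weil_div \<Sigma> Mod range (char_div \<Sigma>)"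

definition div_class :: "(real ^ 'n) set set \<Rightarrow> (int ^ 'n \<Rightarrow>\<^sub>0 int) \<Rightarrow> (int ^ 'n \<Rightarrow>\<^sub>0 int) set" where
  "div_class \<Sigma> D = range (char_div \<Sigma>) #>\<^bsub>weil_div \<Sigma>\<^esub> D"

text \<open>
  Local principality: on the affine chart of each cone the divisor is the divisor of a
  character. The rays of a cone of the fan are the rays of the fan contained in it.
\<close>

definition cartier :: "(real ^ 'n) set set \<Rightarrow> (int ^ 'n \<Rightarrow>\<^sub>0 int) \<Rightarrow> bool" where
  "cartier \<Sigma> D \<longleftrightarrow>
     D \<in> carrier (weil_div \<Sigma>) \<and>
     (\<forall>\<sigma>\<in>\<Sigma>. \<exists>m. \<forall>v\<in>rays \<Sigma>. real_point v \<in> \<sigma> \<longrightarrow>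
        Poly_Mapping.lookup D v = scalar_product m v)"

definition Pic :: "(real ^ 'n) set set \<Rightarrow> (int ^ 'n \<Rightarrow>\<^sub>0 int) set set" where
  "Pic \<Sigma> = div_class \<Sigma> ` {D. cartier \<Sigma> D}"

definition group_rank :: "('a, 'b) monoid_scheme \<Rightarrow> nat \<Rightarrow> bool" where
  "group_rank G k \<longleftrightarrow>
     (\<exists>F. subgroup F G \<and> G\<lparr>carrier := F\<rparr> \<cong> free_Abelian_group {..<k} \<and>
        (\<forall>x\<in>carrier G. \<exists>m::nat. m > 0 \<and> x [^]\<^bsub>G\<^esub> m \<in> F))"

text \<open>
  For a complete toric variety, numerical and linear equivalence of Cartier divisors agree, so
  that the Picard number is the rank of the Picard group.
\<close>

definition picard_number :: "(real ^ 'n) set set \<Rightarrow> nat \<Rightarrow> bool" where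
  "picard_number \<Sigma> k \<longleftrightarrow> group_rank ((Cl \<Sigma>)\<lparr>carrier := Pic \<Sigma>\<rparr>) k"

definition q_factorial :: "(real ^ 'n) set set \<Rightarrow> bool" where
  "q_factorial \<Sigma> \<longleftrightarrow>
     (\<forall>D\<in>carrier (weil_div \<Sigma>). \<exists>k>0. cartier \<Sigma> (frag_cmul k D))"

text \<open>
  Some positive multiple of the divisor is Cartier and has strictly convex support function:
  for each maximal cone, the local equation defines a global section whose nonvanishing locus
  is precisely the affine chart of that cone.
\<close>

definition q_ample :: "(real ^ 'n) set set \<Rightarrow> (int ^ 'n \<Rightarrow>\<^sub>0 int) \<Rightarrow> bool" where
  "q_ample \<Sigma> D \<longleftrightarrow>
     (\<exists>k>0. cartier \<Sigma> (frag_cmul k D) \<and>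
       (\<forall>\<sigma>\<in>\<Sigma>. (\<forall>\<tau>\<in>\<Sigma>. \<sigma> \<subseteq> \<tau> \<longrightarrow> \<tau> = \<sigma>) \<longrightarrow>
         (\<exists>m. \<forall>v\<in>rays \<Sigma>.
            (real_point v \<in> \<sigma> \<longrightarrow> scalar_product m v = k * Poly_Mapping.lookup D v) \<and>
            (real_point v \<notin> \<sigma> \<longrightarrow> scalar_product m v < k * Poly_Mapping.lookup D v))))"

definition anticanonical :: "(real ^ 'n) set set \<Rightarrow> (int ^ 'n \<Rightarrow>\<^sub>0 int)" where
  "anticanonical \<Sigma> = (\<Sum>v\<in>rays \<Sigma>. frag_of v)"

definition fano :: "(real ^ 'n) set set \<Rightarrow> bool" where
  "fano \<Sigma> \<longleftrightarrow> complete_fan \<Sigma> \<and> q_ample \<Sigma> (anticanonical \<Sigma>)"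

definition fwps :: "(real ^ 'n) set set \<Rightarrow> bool" where
  "fwps Z \<longleftrightarrow> fano Z \<and> q_factorial Z \<and> picard_number Z 1"


section \<open>Degree matrices and nef-partitions\<close>

text \<open>The list \<open>[\<mu>\<^sub>1, \<dots>, \<mu>\<^sub>r]\<close> is indexed from zero.\<close>

definition invariant_factors :: "nat list \<Rightarrow> bool" where
  "invariant_factors \<mu> \<longleftrightarrow>
     (\<forall>i<length \<mu>. 2 \<le> \<mu> ! i) \<and>
     (\<forall>i. Suc i < length \<mu> \<longrightarrow> \<mu> ! Suc i dvd \<mu> ! i)"

definition grading_group :: "nat list \<Rightarrow> (int \<times> (nat \<Rightarrow> int)) monoid" where
  "grading_group \<mu> =
     integer_group \<times>\<times> product_group {..<length \<mu>} (\<lambda>i. integer_mod_group (\<mu> ! i))"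

definition prime_class :: "(real ^ 'n) set set \<Rightarrow> int ^ 'n \<Rightarrow> (int ^ 'n \<Rightarrow>\<^sub>0 int) set" where
  "prime_class Z v = div_class Z (frag_of v)"

text \<open>
  The \<open>i\<close>-th column of a degree matrix is \<open>Q i\<close>; only the columns \<open>0, \<dots>, n\<close> matter, where
  \<open>n\<close> is the dimension.
\<close>

definition degree_matrix ::
    "(real ^ 'n) set set \<Rightarrow> nat list \<Rightarrow> (nat \<Rightarrow> int \<times> (nat \<Rightarrow> int)) \<Rightarrow> bool" where
  "degree_matrix Z \<mu> Q \<longleftrightarrow>
     (\<exists>\<phi>\<in>iso (Cl Z) (grading_group \<mu>). \<exists>\<rho>.
        bij_betw \<rho> {0..CARD('n)} (rays Z) \<and>
        (\<forall>i\<in>{0..CARD('n)}. Q i = \<phi> (prime_class Z (\<rho> i)))) \<and>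
     1 \<le> fst (Q 0) \<and>
     (\<forall>i j. i \<le> j \<and> j \<le> CARD('n) \<longrightarrow> fst (Q i) \<le> fst (Q j))"

text \<open>
  The blocks are sets of rays instead of sets of indices, which makes the notion independent
  of the numbering of the torus-invariant prime divisors.
\<close>

definition block_class :: "(real ^ 'n) set set \<Rightarrow> (int ^ 'n) set \<Rightarrow> (int ^ 'n \<Rightarrow>\<^sub>0 int) set" where
  "block_class Z B = finprod (Cl Z) (prime_class Z) B"

definition nef_partition :: "(real ^ 'n) set set \<Rightarrow> (int ^ 'n) set set \<Rightarrow> bool" where
  "nef_partition Z P \<longleftrightarrow>
     partition_on (rays Z) P \<and>
     (\<forall>B\<in>P. block_class Z B \<in> Pic Z \<and> (\<forall>v\<in>rays Z. block_class Z B \<noteq> prime_class Z v))"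

text \<open>
  Elements of \<open>\<int>/2\<int>\<close> are the integers \<open>0\<close> and \<open>1\<close>, as in
  \<^const>\<open>integer_mod_group\<close>; \<open>A i j\<close> is the entry in row \<open>i\<close> and column \<open>j\<close>. The affine span
  consists of all linear combinations over \<open>\<int>/2\<int>\<close> with coefficient sum one.
\<close>

definition mat2 :: "nat \<Rightarrow> nat \<Rightarrow> (nat \<Rightarrow> nat \<Rightarrow> int) \<Rightarrow> bool" where
  "mat2 r s A \<longleftrightarrow> (\<forall>i<r. \<forall>j<s. A i j \<in> carrier (integer_mod_group 2))"

definition col :: "nat \<Rightarrow> (nat \<Rightarrow> nat \<Rightarrow> int) \<Rightarrow> nat \<Rightarrow> (nat \<Rightarrow> int)" where
  "col r A j = (\<lambda>i\<in>{..<r}. A i j)"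

definition affine_span2 :: "nat \<Rightarrow> nat \<Rightarrow> (nat \<Rightarrow> nat \<Rightarrow> int) \<Rightarrow> (nat \<Rightarrow> int) set" where
  "affine_span2 r s A =
     {(\<lambda>i\<in>{..<r}. (\<Sum>j<s. c j * A i j) mod 2) | c. (\<Sum>j<s. c j) mod 2 = 1}"

end

theory Submission
  imports Defs "HOL-Number_Theory.Cong"
begin

text \<open>
  Write \<open>D\<^sub>v\<close> for the prime divisor of the ray \<open>v\<close>, and \<open>w(v)\<close> for the component of its class in the
  free summand of \<open>Cl(Z)\<close>. The argument rests on two facts about the fan. First, since \<open>Cl(Z)\<close> has
  rank one, there are at most \<open>n + 1\<close> rays, and every linear relation among them is a multiple of
  \<open>\<Sum>\<^sub>v w(v) v = 0\<close> (\<open>card_rays_le\<close>, \<open>relation_proportional_to_weights\<close>); since the fan is complete,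
  some relation has positive coefficients, so that all \<open>w(v)\<close> have the same sign and may be taken
  positive (\<open>weight_pos\<close>, \<open>positive_grading_exists\<close>). Second, it follows that any set of rays
  missing one ray lies in a cone of the fan while no cone contains all rays. Hence a divisor is
  Cartier if and only if its class is a multiple of \<open>[D\<^sub>u]\<close> for each ray \<open>u\<close> (\<open>cartier_iff\<close>).

  The class of a block of a nef-partition differs from the classes \<open>[D\<^sub>v]\<close>, so each block has at least
  two elements, which gives the bound. If it is attained, each block is a pair \<open>{a, b}\<close>, and for
  every ray \<open>u\<close> we have \<open>[D\<^sub>a] + [D\<^sub>b] = k[D\<^sub>u]\<close> with \<open>k \<ge> 2\<close> (\<open>nef_pair_class\<close>). Then
  \<open>2 w(u) \<le> w(a) + w(b)\<close> for all rays \<open>u\<close> and all blocks forces the weights to be equal, hence to be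
  one, and \<open>k = 2\<close> (\<open>nef_pairs_weight_one\<close>). Taking \<open>u = b\<close> gives \<open>[D\<^sub>a] = [D\<^sub>b]\<close>, the two equal halves
  of the degree matrix; comparing different \<open>u\<close> shows that the differences \<open>[D\<^sub>u] - [D\<^sub>v]\<close>, which
  generate the torsion of \<open>Cl(Z)\<close>, have order at most two, so that all invariant factors are two
  (\<open>nef_pairs_factors\<close>). The columns span affinely because the \<open>[D\<^sub>v]\<close> generate the class group: an
  element of degree one is a combination of them with coefficient sum one
  (\<open>columns_affinely_span\<close>).

  Conversely, if the two halves of the degree matrix agree and all torsion has order two, then
  \<open>[D\<^sub>a] + [D\<^sub>b] = 2[D\<^sub>u]\<close> for all \<open>u\<close> whenever \<open>a\<close> and \<open>b\<close> are the rays of corresponding columns.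
  These pairs form a nef-partition (\<open>nef_partition_from_equal_columns\<close>).
\<close>

section \<open>Cones of a fan and their rays\<close>

lemma mem_convex_cone_hull_finite:
  fixes S :: "'a::real_vector set"
  assumes "finite S"
  shows "x \<in> convex_cone hull S \<longleftrightarrow>
    (\<exists>a. (\<forall>s\<in>S. 0 \<le> a s) \<and> x = (\<Sum>s\<in>S. a s *\<^sub>R s))"
proof
  let ?C = "{x. \<exists>a. (\<forall>s\<in>S. 0 \<le> a s) \<and> x = (\<Sum>s\<in>S. a s *\<^sub>R s)}"
  have "convex_cone ?C"
    unfolding convex_cone_iff
  proof (intro conjI ballI allI impI)
    show "0 \<in> ?C" by (auto intro!: exI[of _ "\<lambda>_. 0"])
    fix x y assume "x \<in> ?C" "y \<in> ?C"
    then obtain a b where "\<forall>s\<in>S. 0 \<le> a s" "x = (\<Sum>s\<in>S. a s *\<^sub>R s)"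
      "\<forall>s\<in>S. 0 \<le> b s" "y = (\<Sum>s\<in>S. b s *\<^sub>R s)" by auto
    then show "x + y \<in> ?C"
      by (auto intro!: exI[of _ "\<lambda>s. a s + b s"] simp: scaleR_left_distrib sum.distrib)
  next
    fix x :: 'a and c :: real assume "x \<in> ?C" "0 \<le> c"
    then obtain a where "\<forall>s\<in>S. 0 \<le> a s" "x = (\<Sum>s\<in>S. a s *\<^sub>R s)" by auto
    then show "c *\<^sub>R x \<in> ?C" using \<open>0 \<le> c\<close>
      by (auto intro!: exI[of _ "\<lambda>s. c * a s"] simp: scaleR_sum_right)
  qed
  moreover have "S \<subseteq> ?C"
  proof
    fix t assume t: "t \<in> S"
    have "(\<Sum>s\<in>S. (if s = t then 1 else 0) *\<^sub>R s) = (\<Sum>s\<in>S. if s = t then s else 0)"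
      by (rule sum.cong) auto
    also have "\<dots> = t" using t assms by simp
    finally show "t \<in> ?C" by (auto intro!: exI[of _ "\<lambda>s. if s = t then 1 else 0"])
  qed
  ultimately have "convex_cone hull S \<subseteq> ?C" by (simp add: hull_minimal)
  then show "x \<in> convex_cone hull S \<Longrightarrow> \<exists>a. (\<forall>s\<in>S. 0 \<le> a s) \<and> x = (\<Sum>s\<in>S. a s *\<^sub>R s)"
    by auto
next
  assume "\<exists>a. (\<forall>s\<in>S. 0 \<le> a s) \<and> x = (\<Sum>s\<in>S. a s *\<^sub>R s)"
  then obtain a where a: "\<forall>s\<in>S. 0 \<le> a s" and x: "x = (\<Sum>s\<in>S. a s *\<^sub>R s)" by auto
  have "T \<subseteq> S \<Longrightarrow> (\<Sum>s\<in>T. a s *\<^sub>R s) \<in> convex_cone hull S" for T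
  proof (induction T rule: infinite_finite_induct)
    case (insert s T)
    then show ?case
      using a by (auto intro!: convex_cone_hull_add convex_cone_hull_mul intro: hull_inc)
  qed (auto simp: convex_cone_hull_contains_0)
  then show "x \<in> convex_cone hull S" using x by blast
qed

lemma convex_cone_hull_scale_generator: "s \<in> S \<Longrightarrow> 0 \<le> c \<Longrightarrow> c *\<^sub>R s \<in> convex_cone hull S"
  by (intro convex_cone_hull_mul hull_inc)

lemma convex_cone_hull_sum_mem:
  assumes "\<And>i. i \<in> I \<Longrightarrow> x i \<in> convex_cone hull S"
  shows "(\<Sum>i\<in>I. x i) \<in> convex_cone hull S"
  using assms
  by (induction I rule: infinite_finite_induct)
    (auto intro: convex_cone_hull_add simp: convex_cone_hull_contains_0)

lemma convex_cone_hull_remove_redundant: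
  assumes "s \<in> convex_cone hull (T - {s})"
  shows "convex_cone hull (T - {s}) = convex_cone hull T"
proof
  show "convex_cone hull (T - {s}) \<subseteq> convex_cone hull T" by (simp add: hull_mono)
  have "T \<subseteq> convex_cone hull (T - {s})" using assms by (auto intro: hull_inc)
  then show "convex_cone hull T \<subseteq> convex_cone hull (T - {s})"
    by (simp add: convex_cone_convex_cone_hull hull_minimal)
qed

lemma irredundant_generators_exist:
  fixes S :: "'a::real_vector set"
  assumes "finite S"
  obtains T where "T \<subseteq> S" "convex_cone hull T = convex_cone hull S"
    "\<And>s. s \<in> T \<Longrightarrow> s \<notin> convex_cone hull (T - {s})"
proof -
  have "\<exists>T\<subseteq>S. convex_cone hull T = convex_cone hull S \<and>
      (\<forall>s\<in>T. s \<notin> convex_cone hull (T - {s}))"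
    using assms
  proof (induction "card S" arbitrary: S rule: less_induct)
    case less
    show ?case
    proof (cases "\<forall>s\<in>S. s \<notin> convex_cone hull (S - {s})")
      case False
      then obtain s where s: "s \<in> S" "s \<in> convex_cone hull (S - {s})" by auto
      have "card (S - {s}) < card S" using s less.prems by (meson card_Diff1_less)
      then obtain T where "T \<subseteq> S - {s}" "convex_cone hull T = convex_cone hull (S - {s})"
        "\<forall>s\<in>T. s \<notin> convex_cone hull (T - {s})"
        using less.hyps[of "S - {s}"] less.prems by auto
      then show ?thesis using convex_cone_hull_remove_redundant[OF s(2)] by blast
    qed blast
  qed
  then show thesis using that by blast
qed

text \<open>
  If a sum \<open>x + y\<close> of two elements of the cone lies on the ray through \<open>s\<close>, compare
  coefficients: unless all generators other than \<open>s\<close> have coefficient zero, either \<open>s\<close> is a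
  nonnegative combination of the others, or a nontrivial nonnegative combination vanishes, which
  pointedness forbids.
\<close>

lemma irredundant_generator_spans_face:
  fixes T :: "(real ^ 'n) set"
  assumes fin: "finite T" and pointed: "pointed_cone (convex_cone hull T)"
    and s: "s \<in> T" and irr: "\<And>t. t \<in> T \<Longrightarrow> t \<notin> convex_cone hull (T - {t})"
  shows "convex_cone hull {s} face_of convex_cone hull T"
  unfolding face_of_def
proof (intro conjI ballI impI)
  show "convex_cone hull {s} \<subseteq> convex_cone hull T" using s by (simp add: hull_mono)
  show "convex (convex_cone hull {s})" by (rule convex_convex_cone_hull)
  fix x y z assume x: "x \<in> convex_cone hull T" and y: "y \<in> convex_cone hull T"
    and z: "z \<in> convex_cone hull {s}" and zxy: "z \<in> open_segment x y"
  from zxy obtain q where q: "0 < q" "q < 1" "z = (1 - q) *\<^sub>R x + q *\<^sub>R y"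
    by (auto simp: in_segment)
  obtain a where a: "\<forall>t\<in>T. 0 \<le> a t" "x = (\<Sum>t\<in>T. a t *\<^sub>R t)"
    using x mem_convex_cone_hull_finite[OF fin] by auto
  obtain b where b: "\<forall>t\<in>T. 0 \<le> b t" "y = (\<Sum>t\<in>T. b t *\<^sub>R t)"
    using y mem_convex_cone_hull_finite[OF fin] by auto
  obtain e where e: "z = e *\<^sub>R s"
    using z mem_convex_cone_hull_finite[of "{s}" z] by auto
  define c where "c t = (1 - q) * a t + q * b t" for t
  have c0: "\<forall>t\<in>T. 0 \<le> c t" using a b q unfolding c_def by auto
  have "z = (\<Sum>t\<in>T. c t *\<^sub>R t)"
    unfolding c_def q(3) a(2) b(2) by (simp add: scaleR_left_distrib sum.distrib scaleR_sum_right)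
  then have "e *\<^sub>R s = c s *\<^sub>R s + (\<Sum>t\<in>T-{s}. c t *\<^sub>R t)"
    using e s fin by (simp add: sum.remove)
  then have rest: "(\<Sum>t\<in>T-{s}. c t *\<^sub>R t) = (e - c s) *\<^sub>R s" by (simp add: scaleR_left_diff_distrib)
  have restmem: "(\<Sum>t\<in>T-{s}. c t *\<^sub>R t) \<in> convex_cone hull (T - {s})"
    using mem_convex_cone_hull_finite[of "T - {s}"] fin c0 by auto
  have le: "e - c s \<le> 0"
  proof (rule ccontr)
    assume "\<not> e - c s \<le> 0"
    moreover have "(1 / (e - c s)) *\<^sub>R (\<Sum>t\<in>T-{s}. c t *\<^sub>R t) \<in> convex_cone hull (T - {s})"
      using restmem calculation by (intro convex_cone_hull_mul) auto
    ultimately have "s \<in> convex_cone hull (T - {s})" using rest by simp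
    then show False using irr s by blast
  qed
  have zero: "c t = 0" if t: "t \<in> T - {s}" for t
  proof -
    have split: "(\<Sum>t\<in>T-{s}. c t *\<^sub>R t) = c t *\<^sub>R t + (\<Sum>u\<in>T-{s}-{t}. c u *\<^sub>R u)"
      using t fin by (simp add: sum.remove)
    have "- (c t *\<^sub>R t) = (\<Sum>u\<in>T-{s}-{t}. c u *\<^sub>R u) + (c s - e) *\<^sub>R s"
      using rest split by (simp add: algebra_simps)
    moreover have "\<dots> \<in> convex_cone hull T"
      using c0 le s
      by (intro convex_cone_hull_add convex_cone_hull_sum_mem convex_cone_hull_scale_generator) auto
    moreover have "c t *\<^sub>R t \<in> convex_cone hull T"
      using c0 t by (auto intro!: convex_cone_hull_scale_generator)
    ultimately have "c t *\<^sub>R t = 0" using pointed unfolding pointed_cone_def by metis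
    moreover have "t \<noteq> 0" using irr t convex_cone_hull_contains_0 by blast
    ultimately show ?thesis by simp
  qed
  have ab: "a t = 0 \<and> b t = 0" if t: "t \<in> T - {s}" for t
  proof -
    have "(1 - q) * a t \<ge> 0" "q * b t \<ge> 0" using a b q t by auto
    then have "(1 - q) * a t = 0" "q * b t = 0" using zero[OF t] unfolding c_def by linarith+
    then show ?thesis using q by auto
  qed
  have "x = a s *\<^sub>R s" "y = b s *\<^sub>R s"
    using ab s fin unfolding a(2) b(2) by (simp_all add: sum.remove)
  then show "x \<in> convex_cone hull {s}" "y \<in> convex_cone hull {s}"
    using a b s by (auto intro!: convex_cone_hull_scale_generator)
qed

lemma real_point_nth [simp]: "real_point v $ i = real_of_int (v $ i)"
  by (simp add: real_point_def)

lemma real_point_inject [simp]: "real_point u = real_point v \<longleftrightarrow> u = v"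
  by (simp add: vec_eq_iff)

lemma primitive_nonzero: "primitive v \<Longrightarrow> v \<noteq> 0"
  by (auto simp: primitive_def)

lemma primitive_multiple_exists:
  fixes v :: "int ^ 'n"
  assumes "v \<noteq> 0"
  obtains p k where "primitive p" "0 < k" "real_point v = k *\<^sub>R real_point p"
proof -
  define g where "g = Gcd (range (\<lambda>i. v $ i))"
  define p :: "int ^ 'n" where "p = (\<chi> i. v $ i div g)"
  have dvd: "g dvd v $ i" for i unfolding g_def by (rule Gcd_dvd) auto
  have g: "g > 0"
  proof -
    have "g \<noteq> 0" using assms unfolding g_def by (auto simp: Gcd_0_iff vec_eq_iff)
    then show ?thesis unfolding g_def by (metis Gcd_int_greater_eq_0 order_le_less)
  qed
  have pv: "v $ i = g * p $ i" for i using dvd[of i] by (simp add: p_def)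
  have "range (\<lambda>i. v $ i) = (*) g ` range (\<lambda>i. p $ i)" using pv by auto
  then have "g = g * Gcd (range (\<lambda>i. p $ i))"
    unfolding g_def[symmetric] using g g_def by (metis Gcd_int_greater_eq_0 Gcd_mult abs_of_nonneg normalize_int_def zero_le_mult_iff order_less_imp_le)
  then have "primitive p" using g by (simp add: primitive_def)
  moreover have "real_point v = real_of_int g *\<^sub>R real_point p"
    by (simp add: vec_eq_iff pv)
  ultimately show thesis using that g by (metis of_int_0_less_iff)
qed

lemma primitive_proportional_eq:
  fixes u v :: "int ^ 'n"
  assumes u: "primitive u" and v: "primitive v"
    and eq: "real_point u = k *\<^sub>R real_point v" and k: "0 \<le> k"
  shows "u = v"
proof -
  have eqi: "real_of_int (u $ i) = k * real_of_int (v $ i)" for i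
    using arg_cong[OF eq, of "\<lambda>x. x $ i"] by simp
  \<comment> \<open>Taking the greatest common divisor over \<open>i\<close> in \<open>v\<^sub>j u\<^sub>i = u\<^sub>j v\<^sub>i\<close> yields \<open>\<bar>v\<^sub>j\<bar> = \<bar>u\<^sub>j\<bar>\<close>.\<close>
  have cross: "u $ i * v $ j = u $ j * v $ i" for i j
  proof -
    have "real_of_int (u $ i * v $ j) = real_of_int (u $ j * v $ i)" using eqi by simp
    then show ?thesis by linarith
  qed
  have Gcd_mul: "Gcd (range (\<lambda>i. c * x $ i)) = \<bar>c\<bar>" if "primitive x" for c and x :: "int ^ 'n"
  proof -
    have "range (\<lambda>i. c * x $ i) = (*) c ` range (\<lambda>i. x $ i)" by auto
    then show ?thesis using that by (simp add: primitive_def Gcd_mult)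
  qed
  have abs: "\<bar>v $ j\<bar> = \<bar>u $ j\<bar>" for j
  proof -
    have "(\<lambda>i. v $ j * u $ i) = (\<lambda>i. u $ j * v $ i)" using cross by (auto simp: mult.commute)
    then show ?thesis using Gcd_mul[OF u, of "v $ j"] Gcd_mul[OF v, of "u $ j"] by (simp only:)
  qed
  show ?thesis
  proof (rule vec_eq_iff[THEN iffD2], intro allI)
    fix i
    have "real_of_int (u $ i) * real_of_int (v $ i) \<ge> 0" unfolding eqi using k by (simp add: mult.assoc)
    then have "u $ i * v $ i \<ge> 0" by (metis of_int_0_le_iff of_int_mult)
    then show "u $ i = v $ i" using abs[of i] by (auto simp: zero_le_mult_iff abs_if split: if_splits)
  qed
qed

lemma rays_nonzero: "v \<in> rays Z \<Longrightarrow> real_point v \<noteq> 0"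
proof
  assume "v \<in> rays Z" "real_point v = 0"
  then have "primitive v" "v = 0" by (auto simp: rays_def vec_eq_iff)
  then show False using primitive_nonzero by blast
qed

lemma finite_rays:
  assumes "fan Z"
  shows "finite (rays Z)"
proof (rule finite_imageD)
  show "finite ((\<lambda>v. convex_cone hull {real_point v}) ` rays Z)"
    using assms by (rule_tac finite_subset[of _ Z]) (auto simp: rays_def fan_def)
  show "inj_on (\<lambda>v. convex_cone hull {real_point v}) (rays Z)"
  proof (rule inj_onI)
    fix u v assume uv: "u \<in> rays Z" "v \<in> rays Z"
      "convex_cone hull {real_point u} = convex_cone hull {real_point v}"
    have "real_point u \<in> convex_cone hull {real_point v}"
      using uv(3) hull_inc[of "real_point u" "{real_point u}"] by auto
    then obtain k where "0 \<le> k" "real_point u = k *\<^sub>R real_point v"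
      using mem_convex_cone_hull_finite[of "{real_point v}"] by auto
    then show "u = v" using uv primitive_proportional_eq by (auto simp: rays_def)
  qed
qed

text \<open>
  A cone is generated by an irredundant finite set of lattice vectors; each of them spans a
  face, which belongs to the fan, and is a multiple of a primitive vector.
\<close>

lemma cone_generated_by_rays:
  fixes Z :: "(real ^ 'n) set set"
  assumes fan: "fan Z" and \<sigma>: "\<sigma> \<in> Z" and x: "x \<in> \<sigma>"
  obtains a where "\<And>v. v \<in> rays Z \<Longrightarrow> 0 \<le> a v"
    "\<And>v. v \<in> rays Z \<Longrightarrow> real_point v \<notin> \<sigma> \<Longrightarrow> a v = 0"
    "x = (\<Sum>v\<in>rays Z. a v *\<^sub>R real_point v)"
proof -
  let ?R = "{v \<in> rays Z. real_point v \<in> \<sigma>}"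
  from fan \<sigma> obtain S :: "(int ^ 'n) set" where S: "finite S" "\<sigma> = convex_cone hull (real_point ` S)"
    by (auto simp: fan_def rational_polyhedral_cone_def)
  obtain T where T: "T \<subseteq> real_point ` S" "convex_cone hull T = \<sigma>"
    and irr: "\<And>s. s \<in> T \<Longrightarrow> s \<notin> convex_cone hull (T - {s})"
    using irredundant_generators_exist[of "real_point ` S"] S by auto
  have finT: "finite T" using T S finite_subset by blast
  have pointed: "pointed_cone (convex_cone hull T)" using fan \<sigma> T by (auto simp: fan_def)
  have "s \<in> convex_cone hull (real_point ` ?R)" if s: "s \<in> T" for s
  proof -
    obtain v where v: "s = real_point v" using s T by auto
    have "s \<noteq> 0" using irr s convex_cone_hull_contains_0 by blast
    then have "v \<noteq> 0" using v by (auto simp: vec_eq_iff)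
    then obtain p k where p: "primitive p" "0 < k" "s = k *\<^sub>R real_point p"
      using primitive_multiple_exists v by metis
    have p': "real_point p = (1/k) *\<^sub>R s" using p by simp
    have "convex_cone hull {s} face_of \<sigma>"
      using irredundant_generator_spans_face[OF finT pointed s irr] T by simp
    then have inZ: "convex_cone hull {s} \<in> Z"
      using fan \<sigma> convex_cone_hull_nonempty[of "{s}"] unfolding fan_def by blast
    have "convex_cone hull {s} = convex_cone hull {real_point p}"
    proof
      show "convex_cone hull {s} \<subseteq> convex_cone hull {real_point p}"
        using p by (intro hull_minimal) (auto simp: convex_cone_convex_cone_hull intro!: convex_cone_hull_scale_generator)
      show "convex_cone hull {real_point p} \<subseteq> convex_cone hull {s}"
        using convex_cone_hull_scale_generator[of s "{s}" "1/k"] p(2)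
        by (intro hull_minimal) (auto simp: convex_cone_convex_cone_hull p')
    qed
    then have "p \<in> rays Z" using inZ p by (simp add: rays_def)
    moreover have "real_point p \<in> \<sigma>"
      using s p(2) unfolding p' T(2)[symmetric] by (intro convex_cone_hull_mul hull_inc) auto
    ultimately show ?thesis using p by (auto intro!: convex_cone_hull_scale_generator)
  qed
  then have "\<sigma> \<subseteq> convex_cone hull (real_point ` ?R)"
    unfolding T(2)[symmetric] by (intro hull_minimal) (auto simp: convex_cone_convex_cone_hull)
  then have "x \<in> convex_cone hull (real_point ` ?R)" using x by auto
  then obtain b where b: "\<forall>s\<in>real_point ` ?R. 0 \<le> b s" "x = (\<Sum>s\<in>real_point ` ?R. b s *\<^sub>R s)"
    using mem_convex_cone_hull_finite[of "real_point ` ?R"] finite_rays[OF fan] by auto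
  define a where "a v = (if real_point v \<in> \<sigma> then b (real_point v) else 0)" for v
  have "x = (\<Sum>v\<in>?R. b (real_point v) *\<^sub>R real_point v)"
    unfolding b(2) by (subst sum.reindex) (auto simp: inj_on_def)
  also have "\<dots> = (\<Sum>v\<in>rays Z. a v *\<^sub>R real_point v)"
    by (rule sum.mono_neutral_cong_left) (auto simp: finite_rays[OF fan] a_def)
  finally show thesis using b by (intro that[of a]) (auto simp: a_def)
qed

text \<open>The negated sum of all rays lies in some cone, hence is a nonnegative combination of rays.\<close>

lemma complete_fan_positive_relation:
  assumes "complete_fan Z"
  obtains p :: "int ^ 'n \<Rightarrow> real" where "\<And>v. v \<in> rays Z \<Longrightarrow> 0 < p v" "(\<Sum>v\<in>rays Z. p v *\<^sub>R real_point v) = 0"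
proof -
  let ?x = "- (\<Sum>v\<in>rays Z. real_point v)"
  have "?x \<in> \<Union>Z" using assms by (simp add: complete_fan_def)
  then obtain \<sigma> where \<sigma>: "\<sigma> \<in> Z" "?x \<in> \<sigma>" by blast
  have "fan Z" using assms by (simp add: complete_fan_def)
  from cone_generated_by_rays[OF this \<sigma>] obtain a where
    a: "\<And>v. v \<in> rays Z \<Longrightarrow> 0 \<le> a v" "?x = (\<Sum>v\<in>rays Z. a v *\<^sub>R real_point v)" by metis
  show thesis
  proof (rule that[of "\<lambda>v. 1 + a v"])
    show "\<And>v. v \<in> rays Z \<Longrightarrow> 0 < 1 + a v" using a(1) by (simp add: add_pos_nonneg)
    show "(\<Sum>v\<in>rays Z. (1 + a v) *\<^sub>R real_point v) = 0"
      using a(2) by (simp add: scaleR_left_distrib sum.distrib flip: a(2))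
  qed
qed

section \<open>Principal divisors\<close>

lemma lookup_char_div:
  assumes "finite (rays Z)"
  shows "Poly_Mapping.lookup (char_div Z m) v = (if v \<in> rays Z then scalar_product m v else 0)"
proof -
  have "Poly_Mapping.lookup (char_div Z m) v =
      (\<Sum>u\<in>rays Z. if v = u then scalar_product m u else 0)"
    unfolding char_div_def lookup_sum by (intro sum.cong) auto
  then show ?thesis using assms by simp
qed

lemma keys_char_div:
  assumes "finite (rays Z)"
  shows "Poly_Mapping.keys (char_div Z m) \<subseteq> rays Z"
proof
  fix v assume "v \<in> Poly_Mapping.keys (char_div Z m)"
  then have "Poly_Mapping.lookup (char_div Z m) v \<noteq> 0" by (rule in_keys_iff[THEN iffD1])
  then show "v \<in> rays Z" by (metis lookup_char_div[OF assms])
qed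

lemma char_div_eqI:
  assumes "finite (rays Z)" "Poly_Mapping.keys D \<subseteq> rays Z"
    "\<And>v. v \<in> rays Z \<Longrightarrow> Poly_Mapping.lookup D v = scalar_product m v"
  shows "D = char_div Z m"
proof (rule poly_mapping_eqI)
  fix v
  have "v \<notin> rays Z \<Longrightarrow> Poly_Mapping.lookup D v = 0"
    using assms(2) by (meson in_keys_iff subsetD)
  then show "Poly_Mapping.lookup D v = Poly_Mapping.lookup (char_div Z m) v"
    using assms(3) by (simp add: lookup_char_div[OF assms(1)])
qed

abbreviation principal_div :: "(real ^ 'n) set set \<Rightarrow> (int ^ 'n \<Rightarrow>\<^sub>0 int) \<Rightarrow> bool" where
  "principal_div Z D \<equiv> D \<in> range (char_div Z)"

lemma principal_0: "finite (rays Z) \<Longrightarrow> principal_div Z 0"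
  by (intro range_eqI[of _ _ 0] char_div_eqI) (auto simp: scalar_product_def)

lemma principal_add:
  assumes fin: "finite (rays Z)" and "principal_div Z D" "principal_div Z D'"
  shows "principal_div Z (D + D')"
proof -
  obtain m m' where "D = char_div Z m" "D' = char_div Z m'" using assms by auto
  then have "D + D' = char_div Z (m + m')"
    using fin by (auto intro!: poly_mapping_eqI
        simp: lookup_add lookup_char_div scalar_product_def algebra_simps sum.distrib)
  then show ?thesis by simp
qed

lemma principal_cmul:
  assumes fin: "finite (rays Z)" and "principal_div Z D"
  shows "principal_div Z (frag_cmul k D)"
proof -
  obtain m where "D = char_div Z m" using assms by auto
  then have "frag_cmul k D = char_div Z (k *s m)"
    using fin by (auto intro!: poly_mapping_eqI
        simp: lookup_char_div scalar_product_def sum_distrib_left mult.assoc)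
  then show ?thesis by simp
qed

lemma principal_minus: "finite (rays Z) \<Longrightarrow> principal_div Z D \<Longrightarrow> principal_div Z (- D)"
  using principal_cmul[of Z D "-1"] by simp

lemma principal_diff:
  "finite (rays Z) \<Longrightarrow> principal_div Z D \<Longrightarrow> principal_div Z D' \<Longrightarrow> principal_div Z (D - D')"
  using principal_add[of Z D "- D'"] principal_minus[of Z D'] by (simp only: diff_conv_add_uminus)

lemma principal_trans:
  "finite (rays Z) \<Longrightarrow> principal_div Z (D - D') \<Longrightarrow> principal_div Z (D' - D'') \<Longrightarrow>
    principal_div Z (D - D'')"
  using principal_add[of Z "D - D'" "D' - D''"] by simp

lemma principal_sym:
  "finite (rays Z) \<Longrightarrow> principal_div Z (D - D') \<Longrightarrow> principal_div Z (D' - D)"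
  using principal_minus[of Z "D - D'"] by simp

lemma principal_sum:
  "finite (rays Z) \<Longrightarrow> (\<And>i. i \<in> I \<Longrightarrow> principal_div Z (D i)) \<Longrightarrow> principal_div Z (\<Sum>i\<in>I. D i)"
  by (induction I rule: infinite_finite_induct) (simp_all add: principal_0 principal_add)

section \<open>The relation among the rays\<close>

lemma inner_real_point: "real_point m \<bullet> real_point v = real_of_int (scalar_product m v)"
  by (simp add: inner_vec_def scalar_product_def)

text \<open>
  The assumptions \<open>relation\<close> and \<open>torsion\<close> say that \<open>D\<^sub>v \<mapsto> w(v)\<close> induces a homomorphism from the class group to
  the integers whose kernel is torsion. They are stated by divisors, since the linear algebra below
  needs explicit characters.
\<close>

locale weighted_complete_fan =
  fixes Z :: "(real ^ 'n) set set" and w :: "int ^ 'n \<Rightarrow> int"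
  assumes complete: "complete_fan Z"
    and relation: "(\<Sum>v\<in>rays Z. scalar_product m v * w v) = 0"
    and torsion: "\<exists>N>0. \<forall>D. Poly_Mapping.keys D \<subseteq> rays Z \<longrightarrow>
      (\<Sum>v\<in>rays Z. Poly_Mapping.lookup D v * w v) = 0 \<longrightarrow> principal_div Z (frag_cmul N D)"
    and some_pos: "\<exists>u\<in>rays Z. 0 < w u"
begin

lemma fin: "finite (rays Z)"
  using complete finite_rays by (auto simp: complete_fan_def)

lemma weights_relation: "(\<Sum>v\<in>rays Z. real_of_int (w v) *\<^sub>R real_point v) = 0"
proof (rule vec_eq_iff[THEN iffD2], intro allI)
  fix i
  have sp: "scalar_product (axis i 1) v = v $ i" for v :: "int ^ 'n"
    by (simp add: scalar_product_def axis_def if_distrib[of "\<lambda>x. x * _"] cong: if_cong)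
  have "(\<Sum>v\<in>rays Z. real_of_int (w v) * real_of_int (v $ i)) =
      real_of_int (\<Sum>v\<in>rays Z. scalar_product (axis i 1) v * w v)"
    by (simp add: sp mult.commute)
  then show "(\<Sum>v\<in>rays Z. real_of_int (w v) *\<^sub>R real_point v) $ i = (0 :: real ^ 'n) $ i"
    by (simp add: relation)
qed

text \<open>
  For a ray \<open>v \<noteq> u\<close> the divisor \<open>w(u) D\<^sub>v - w(v) D\<^sub>u\<close> has degree zero, so a multiple of it is the
  divisor of a character. Up to a factor, this character is the coordinate function
  of \<open>v\<close> with respect to the rays other than \<open>u\<close>.
\<close>

lemma relation_vanishing_at_one_ray:
  assumes u: "u \<in> rays Z" "w u \<noteq> 0"
    and rel: "(\<Sum>v\<in>rays Z. c v *\<^sub>R real_point v) = 0" and cu: "c u = 0" and v: "v \<in> rays Z"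
  shows "c v = 0"
proof (cases "v = u")
  case False
  define D where "D = frag_cmul (w u) (frag_of v) - frag_cmul (w v) (frag_of u)"
  have lD: "Poly_Mapping.lookup D x = (if x = v then w u else 0) - (if x = u then w v else 0)" for x
    by (simp add: D_def lookup_minus)
  have "Poly_Mapping.keys D \<subseteq> rays Z" using u v by (auto simp: in_keys_iff lD split: if_splits)
  moreover have "(\<Sum>x\<in>rays Z. Poly_Mapping.lookup D x * w x) = 0"
    using u v fin by (simp add: lD left_diff_distrib sum_subtractf if_distrib[of "\<lambda>x. x * _"] cong: if_cong)
  ultimately obtain N m where N: "N > 0" "frag_cmul N D = char_div Z m" using torsion by blast
  have sp: "scalar_product m x = N * Poly_Mapping.lookup D x" if "x \<in> rays Z" for x
    using arg_cong[OF N(2), of "\<lambda>E. Poly_Mapping.lookup E x"] that fin by (simp add: lookup_char_div)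
  have "0 = real_point m \<bullet> (\<Sum>x\<in>rays Z. c x *\<^sub>R real_point x)" using rel by simp
  also have "\<dots> = (\<Sum>x\<in>rays Z. c x * real_of_int (scalar_product m x))"
    by (simp add: inner_sum_right inner_real_point)
  also have "\<dots> = (\<Sum>x\<in>rays Z. if x = v then c v * (real_of_int N * real_of_int (w u)) else 0)"
    using cu by (intro sum.cong) (auto simp: sp lD)
  also have "\<dots> = c v * (real_of_int N * real_of_int (w u))" using v fin by simp
  finally show ?thesis using N u by simp
qed (use cu in simp)

lemma relation_proportional_to_weights:
  assumes u: "u \<in> rays Z" "w u \<noteq> 0" and rel: "(\<Sum>v\<in>rays Z. c v *\<^sub>R real_point v) = 0"
    and v: "v \<in> rays Z"
  shows "c v = c u / real_of_int (w u) * real_of_int (w v)"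
proof -
  let ?t = "c u / real_of_int (w u)"
  have "(\<Sum>v\<in>rays Z. (c v - ?t * real_of_int (w v)) *\<^sub>R real_point v) =
      (\<Sum>v\<in>rays Z. c v *\<^sub>R real_point v) - ?t *\<^sub>R (\<Sum>v\<in>rays Z. real_of_int (w v) *\<^sub>R real_point v)"
    by (simp add: scaleR_left_diff_distrib sum_subtractf scaleR_sum_right)
  then have "(\<Sum>v\<in>rays Z. (c v - ?t * real_of_int (w v)) *\<^sub>R real_point v) = 0"
    using rel weights_relation by simp
  then have "c v - ?t * real_of_int (w v) = 0"
    by (rule relation_vanishing_at_one_ray[OF u]) (use u v in auto)
  then show ?thesis by simp
qed

text \<open>Completeness yields some positive relation, and the weights are the only one up to scaling.\<close>

lemma weight_pos:
  assumes "v \<in> rays Z"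
  shows "0 < w v"
proof -
  obtain u where u: "u \<in> rays Z" "0 < w u" using some_pos by blast
  obtain p where p: "\<And>v. v \<in> rays Z \<Longrightarrow> 0 < p v" "(\<Sum>v\<in>rays Z. p v *\<^sub>R real_point v) = 0"
    using complete_fan_positive_relation[OF complete] by metis
  have "p v = p u / real_of_int (w u) * real_of_int (w v)"
    using relation_proportional_to_weights[of u p v] u p assms by simp
  moreover have "0 < p v" "0 < p u / real_of_int (w u)" using p u assms by auto
  ultimately have "0 < real_of_int (w v)" by (metis zero_less_mult_pos)
  then show ?thesis by simp
qed

lemma card_rays_le: "card (rays Z) \<le> CARD('n) + 1"
proof -
  obtain u where u: "u \<in> rays Z" "0 < w u" using some_pos by blast
  have inj: "inj_on real_point A" for A :: "(int ^ 'n) set" by (auto simp: inj_on_def)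
  have "independent (real_point ` (rays Z - {u}))"
  proof (rule independent_if_scalars_zero)
    show "finite (real_point ` (rays Z - {u}))" using fin by simp
    fix f x assume 0: "(\<Sum>x\<in>real_point ` (rays Z - {u}). f x *\<^sub>R x) = 0"
      and "x \<in> real_point ` (rays Z - {u})"
    then obtain v where v: "v \<in> rays Z - {u}" "x = real_point v" by auto
    define c where "c v = (if v = u then 0 else f (real_point v))" for v
    have "(\<Sum>v\<in>rays Z. c v *\<^sub>R real_point v) = (\<Sum>v\<in>rays Z - {u}. f (real_point v) *\<^sub>R real_point v)"
      using fin by (intro sum.mono_neutral_cong_right) (auto simp: c_def)
    also have "\<dots> = 0" using 0 by (simp add: sum.reindex[OF inj])
    finally have "(\<Sum>v\<in>rays Z. c v *\<^sub>R real_point v) = 0" .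
    then have "c v = 0"
      using relation_vanishing_at_one_ray[of u c v] u v by (simp add: c_def)
    then show "f x = 0" using v by (simp add: c_def)
  qed
  then have "card (real_point ` (rays Z - {u})) \<le> DIM(real ^ 'n)" by (rule independent_bound[THEN conjunct2])
  then show ?thesis using u fin by (simp add: card_image[OF inj])
qed

text \<open>
  The sum of the rays other than \<open>u\<close> lies in some cone. Its expression by the rays of that cone
  differs from the original one by a nonnegative multiple of the weight relation, hence involves
  all rays other than \<open>u\<close>.
\<close>

lemma facet_cone_exists:
  assumes u: "u \<in> rays Z"
  obtains \<sigma> where "\<sigma> \<in> Z" "\<And>v. v \<in> rays Z \<Longrightarrow> v \<noteq> u \<Longrightarrow> real_point v \<in> \<sigma>"
proof -
  let ?x = "\<Sum>v\<in>rays Z. (if v = u then 0 else 1::real) *\<^sub>R real_point v"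
  have "?x \<in> \<Union>Z" using complete by (simp add: complete_fan_def)
  then obtain \<sigma> where \<sigma>: "\<sigma> \<in> Z" "?x \<in> \<sigma>" by blast
  have "fan Z" using complete by (simp add: complete_fan_def)
  then obtain a where
    a: "\<And>v. v \<in> rays Z \<Longrightarrow> 0 \<le> a v" "\<And>v. v \<in> rays Z \<Longrightarrow> real_point v \<notin> \<sigma> \<Longrightarrow> a v = 0"
      "?x = (\<Sum>v\<in>rays Z. a v *\<^sub>R real_point v)"
    using \<sigma> by (rule cone_generated_by_rays) blast
  define c where "c v = a v - (if v = u then 0 else 1)" for v
  have "(\<Sum>v\<in>rays Z. c v *\<^sub>R real_point v) = 0"
    unfolding c_def using a(3) by (simp add: scaleR_left_diff_distrib sum_subtractf)
  then have c: "c v = c u / real_of_int (w u) * real_of_int (w v)" if "v \<in> rays Z" for v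
    using relation_proportional_to_weights[OF u] weight_pos[OF u] that by simp
  have "real_point v \<in> \<sigma>" if v: "v \<in> rays Z" "v \<noteq> u" for v
  proof (rule ccontr)
    assume "real_point v \<notin> \<sigma>"
    then have "c v = -1" using a(2) v by (simp add: c_def)
    moreover have "0 \<le> c u / real_of_int (w u) * real_of_int (w v)"
      using a(1)[OF u] weight_pos[OF u] weight_pos[OF v(1)] by (simp add: c_def)
    ultimately show False using c[OF v(1)] by linarith
  qed
  then show thesis using that \<sigma> by blast
qed

text \<open>
  The opposite of one ray is a positive combination of the others, so that a cone containing all
  rays is not pointed.
\<close>

lemma cone_misses_some_ray:
  assumes "\<sigma> \<in> Z"
  shows "\<exists>u\<in>rays Z. real_point u \<notin> \<sigma>"
proof (rule ccontr)
  assume "\<not> ?thesis"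
  then have all: "\<And>v. v \<in> rays Z \<Longrightarrow> real_point v \<in> \<sigma>" by blast
  obtain u where u: "u \<in> rays Z" using some_pos by blast
  have \<sigma>: "pointed_cone \<sigma>" "rational_polyhedral_cone \<sigma>"
    using complete assms by (auto simp: complete_fan_def fan_def)
  then obtain S where S: "\<sigma> = convex_cone hull S" by (auto simp: rational_polyhedral_cone_def)
  have mem: "real_of_int (w v) *\<^sub>R real_point v \<in> \<sigma>" if "v \<in> rays Z" for v
    using all[OF that] weight_pos[OF that] unfolding S by (simp add: convex_cone_hull_mul)
  have "real_of_int (w u) *\<^sub>R real_point u + (\<Sum>v\<in>rays Z - {u}. real_of_int (w v) *\<^sub>R real_point v) = 0"
    using weights_relation u fin by (simp add: sum.remove)
  moreover have "(\<Sum>v\<in>rays Z - {u}. real_of_int (w v) *\<^sub>R real_point v) \<in> \<sigma>"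
    using mem unfolding S by (intro convex_cone_hull_sum_mem) auto
  ultimately have "- (real_of_int (w u) *\<^sub>R real_point u) \<in> \<sigma>" by (metis add.inverse_unique)
  then have "real_of_int (w u) *\<^sub>R real_point u = 0"
    using \<sigma>(1) mem[OF u] unfolding pointed_cone_def by blast
  then show False using rays_nonzero[OF u] weight_pos[OF u] by simp
qed

text \<open>
  On the chart of the cone spanned by all rays but \<open>u\<close>, being principal means being linearly
  equivalent to a multiple of \<open>D\<^sub>u\<close>. In terms of the class group, \<open>Pic(Z)\<close> is the intersection of
  the cyclic groups generated by the classes \<open>[D\<^sub>u]\<close>.
\<close>

lemma cartier_iff:
  "cartier Z D \<longleftrightarrow> Poly_Mapping.keys D \<subseteq> rays Z \<and>
     (\<forall>u\<in>rays Z. \<exists>k. principal_div Z (D - frag_cmul k (frag_of u)))"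
proof (intro iffI conjI ballI)
  assume D: "cartier Z D"
  then show keys: "Poly_Mapping.keys D \<subseteq> rays Z" by (simp add: cartier_def weil_div_def)
  fix u assume u: "u \<in> rays Z"
  obtain \<sigma> where \<sigma>: "\<sigma> \<in> Z" "\<And>v. v \<in> rays Z \<Longrightarrow> v \<noteq> u \<Longrightarrow> real_point v \<in> \<sigma>"
    using facet_cone_exists[OF u] by metis
  then obtain m where m: "\<And>v. v \<in> rays Z \<Longrightarrow> real_point v \<in> \<sigma> \<Longrightarrow> Poly_Mapping.lookup D v = scalar_product m v"
    using D unfolding cartier_def by meson
  define k where "k = Poly_Mapping.lookup D u - scalar_product m u"
  have "D - frag_cmul k (frag_of u) = char_div Z m"
  proof (rule char_div_eqI[OF fin])
    show "Poly_Mapping.keys (D - frag_cmul k (frag_of u)) \<subseteq> rays Z"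
      using keys u keys_diff[of D "frag_cmul k (frag_of u)"] keys_cmul[of k "frag_of u"] by auto
    fix v assume "v \<in> rays Z"
    then show "Poly_Mapping.lookup (D - frag_cmul k (frag_of u)) v = scalar_product m v"
      using m \<sigma> by (auto simp: lookup_minus k_def)
  qed
  then show "\<exists>k. principal_div Z (D - frag_cmul k (frag_of u))" by (metis rangeI)
next
  assume *: "Poly_Mapping.keys D \<subseteq> rays Z \<and>
     (\<forall>u\<in>rays Z. \<exists>k. principal_div Z (D - frag_cmul k (frag_of u)))"
  have "\<exists>m. \<forall>v\<in>rays Z. real_point v \<in> \<sigma> \<longrightarrow> Poly_Mapping.lookup D v = scalar_product m v"
    if \<sigma>: "\<sigma> \<in> Z" for \<sigma>
  proof -
    obtain u where u: "u \<in> rays Z" "real_point u \<notin> \<sigma>" using cone_misses_some_ray[OF \<sigma>] by blast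
    then obtain k m where km: "D - frag_cmul k (frag_of u) = char_div Z m" using * by blast
    have "Poly_Mapping.lookup D v = scalar_product m v" if "v \<in> rays Z" "real_point v \<in> \<sigma>" for v
      using arg_cong[OF km, of "\<lambda>E. Poly_Mapping.lookup E v"] that u
      by (auto simp: lookup_minus lookup_char_div[OF fin] split: if_splits)
    then show ?thesis by blast
  qed
  then show "cartier Z D" using * by (simp add: cartier_def weil_div_def)
qed

end

section \<open>The class group\<close>

lemma carrier_weil_div [simp]: "D \<in> carrier (weil_div Z) \<longleftrightarrow> Poly_Mapping.keys D \<subseteq> rays Z"
  by (simp add: weil_div_def)

lemma carrier_weil_div_eq: "carrier (weil_div Z) = {D. Poly_Mapping.keys D \<subseteq> rays Z}"
  by auto

lemma mult_weil_div [simp]: "D \<otimes>\<^bsub>weil_div Z\<^esub> D' = D + D'"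
  by (simp add: weil_div_def)

lemma comm_group_weil_div: "comm_group (weil_div Z)"
  by (simp add: weil_div_def abelian_free_Abelian_group)

lemma subgroup_principal_div:
  assumes fin: "finite (rays Z)"
  shows "subgroup (range (char_div Z)) (weil_div Z)"
proof (rule subgroup.intro)
  show "range (char_div Z) \<subseteq> carrier (weil_div Z)" using keys_char_div[OF fin] by auto
  show "x \<otimes>\<^bsub>weil_div Z\<^esub> y \<in> range (char_div Z)" if "principal_div Z x" "principal_div Z y" for x y
    using principal_add[OF fin that] by simp
  show "\<one>\<^bsub>weil_div Z\<^esub> \<in> range (char_div Z)" using principal_0[OF fin] by (simp add: weil_div_def)
  show "inv\<^bsub>weil_div Z\<^esub> x \<in> range (char_div Z)" if "principal_div Z x" for x
  proof -
    have "Poly_Mapping.keys x \<subseteq> rays Z" using keys_char_div[OF fin] that by auto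
    then show ?thesis using principal_minus[OF fin that] by (simp add: weil_div_def)
  qed
qed

lemma comm_group_Cl: "finite (rays Z) \<Longrightarrow> comm_group (Cl Z)"
  unfolding Cl_def using comm_group.abelian_FactGroup[OF comm_group_weil_div subgroup_principal_div] .

lemma div_class_hom: "finite (rays Z) \<Longrightarrow> div_class Z \<in> hom (weil_div Z) (Cl Z)"
  unfolding Cl_def div_class_def
  using comm_group.normal_iff_subgroup[OF comm_group_weil_div, of "range (char_div Z)"]
    subgroup_principal_div[of Z]
  by (intro normal.r_coset_hom_Mod) simp

lemma carrier_Cl: "carrier (Cl Z) = div_class Z ` {D. Poly_Mapping.keys D \<subseteq> rays Z}"
  unfolding Cl_def carrier_FactGroup div_class_def carrier_weil_div_eq ..

lemma div_class_eq_iff: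
  assumes fin: "finite (rays Z)"
  shows "div_class Z D = div_class Z D' \<longleftrightarrow> principal_div Z (D - D')"
proof -
  have cl: "div_class Z E = {F. principal_div Z (F - E)}" for E
    unfolding div_class_def r_coset_def by (auto simp: image_iff) (metis add_diff_cancel diff_add_cancel)+
  show ?thesis
  proof
    assume "div_class Z D = div_class Z D'"
    moreover have "D \<in> div_class Z D" using principal_0[OF fin] by (simp add: cl)
    ultimately show "principal_div Z (D - D')" by (simp add: cl)
  next
    assume p: "principal_div Z (D - D')"
    have "principal_div Z (F - D) \<longleftrightarrow> principal_div Z (F - D')" for F
    proof
      assume "principal_div Z (F - D)"
      from principal_add[OF fin this p] show "principal_div Z (F - D')" by simp
    next
      assume "principal_div Z (F - D')"
      from principal_diff[OF fin this p] show "principal_div Z (F - D)" by simp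
    qed
    then show "div_class Z D = div_class Z D'" by (simp add: cl)
  qed
qed

lemma block_class_eq:
  assumes fin: "finite (rays Z)" and B: "B \<subseteq> rays Z"
  shows "block_class Z B = div_class Z (\<Sum>v\<in>B. frag_of v)"
proof -
  interpret Cl: comm_group "Cl Z" by (rule comm_group_Cl[OF fin])
  interpret W: comm_group "weil_div Z" by (rule comm_group_weil_div)
  interpret h: group_hom "weil_div Z" "Cl Z" "div_class Z"
    by (intro group_hom.intro group_hom_axioms.intro div_class_hom[OF fin] W.is_group Cl.is_group)
  have "finite B" using B fin finite_subset by blast
  then show ?thesis using B
  proof (induction B)
    case empty
    have "div_class Z \<one>\<^bsub>weil_div Z\<^esub> = \<one>\<^bsub>Cl Z\<^esub>" by (rule h.hom_one)
    then show ?case by (simp add: block_class_def weil_div_def)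
  next
    case (insert v B)
    have pc: "prime_class Z u \<in> carrier (Cl Z)" if "u \<in> rays Z" for u
      using that by (auto simp: carrier_Cl prime_class_def)
    have keys: "Poly_Mapping.keys (\<Sum>v\<in>B. frag_of v) \<subseteq> rays Z"
      using insert.prems keys_sum[of frag_of B] by auto
    have "block_class Z (insert v B) = prime_class Z v \<otimes>\<^bsub>Cl Z\<^esub> block_class Z B"
      unfolding block_class_def using insert pc by (intro Cl.finprod_insert) auto
    also have "\<dots> = div_class Z (frag_of v) \<otimes>\<^bsub>Cl Z\<^esub> div_class Z (\<Sum>v\<in>B. frag_of v)"
      using insert by (simp add: prime_class_def)
    also have "\<dots> = div_class Z (frag_of v \<otimes>\<^bsub>weil_div Z\<^esub> (\<Sum>v\<in>B. frag_of v))"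
      using insert.prems keys by (intro h.hom_mult[symmetric]) auto
    finally show ?case using insert by simp
  qed
qed

lemma keys_add_subset:
  "Poly_Mapping.keys D \<subseteq> S \<Longrightarrow> Poly_Mapping.keys D' \<subseteq> S \<Longrightarrow> Poly_Mapping.keys (D + D') \<subseteq> S"
  using keys_add[of D D'] by blast

lemma keys_diff_subset:
  "Poly_Mapping.keys D \<subseteq> S \<Longrightarrow> Poly_Mapping.keys D' \<subseteq> S \<Longrightarrow> Poly_Mapping.keys (D - D') \<subseteq> S"
  using keys_diff[of D D'] by blast

lemma keys_cmul_subset: "Poly_Mapping.keys D \<subseteq> S \<Longrightarrow> Poly_Mapping.keys (frag_cmul k D) \<subseteq> S"
  using keys_cmul[of k D] by blast

text \<open>
  Serves the torsion components with \<open>m = \<mu>\<^sub>i\<close>, and the degree with \<open>m = 0\<close>, for which the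
  congruence is an equation.
\<close>

lemma congruence_additive_expand:
  fixes g :: "('a \<Rightarrow>\<^sub>0 int) \<Rightarrow> int"
  assumes add: "\<And>D D'. Poly_Mapping.keys D \<subseteq> S \<Longrightarrow> Poly_Mapping.keys D' \<subseteq> S \<Longrightarrow>
      [g (D + D') = g D + g D'] (mod m)"
    and S: "finite S" and D: "Poly_Mapping.keys D \<subseteq> S"
  shows "[g D = (\<Sum>v\<in>S. Poly_Mapping.lookup D v * g (frag_of v))] (mod m)"
proof (rule free_Abelian_group_induct[OF D])
  show "[g 0 = (\<Sum>v\<in>S. Poly_Mapping.lookup 0 v * g (frag_of v))] (mod m)"
    using add[of 0 0] by (simp add: cong_iff_dvd_diff)
next
  fix x y
  assume xy: "Poly_Mapping.keys x \<subseteq> S" "Poly_Mapping.keys y \<subseteq> S"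
    "[g x = (\<Sum>v\<in>S. Poly_Mapping.lookup x v * g (frag_of v))] (mod m)"
    "[g y = (\<Sum>v\<in>S. Poly_Mapping.lookup y v * g (frag_of v))] (mod m)"
  have "[g x = g (x - y) + g y] (mod m)"
    using add[of "x - y" y] xy keys_diff_subset[of x S y] by simp
  then have "[g x - g y = g (x - y) + g y - g y] (mod m)"
    by (intro cong_diff) auto
  then have "[g (x - y) = g x - g y] (mod m)" by (simp add: cong_sym)
  also have "[g x - g y = (\<Sum>v\<in>S. Poly_Mapping.lookup x v * g (frag_of v)) -
      (\<Sum>v\<in>S. Poly_Mapping.lookup y v * g (frag_of v))] (mod m)"
    using xy by (intro cong_diff) auto
  finally show "[g (x - y) = (\<Sum>v\<in>S. Poly_Mapping.lookup (x - y) v * g (frag_of v))] (mod m)"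
    by (simp add: lookup_minus left_diff_distrib sum_subtractf)
next
  fix a assume a: "a \<in> S"
  have "(\<Sum>v\<in>S. Poly_Mapping.lookup (frag_of a) v * g (frag_of v)) =
      (\<Sum>v\<in>S. if v = a then g (frag_of v) else 0)"
    by (intro sum.cong) auto
  then show "[g (frag_of a) = (\<Sum>v\<in>S. Poly_Mapping.lookup (frag_of a) v * g (frag_of v))] (mod m)"
    using a S by simp
qed

section \<open>Degrees and torsion components\<close>

locale complete_fan_grading =
  fixes Z :: "(real ^ 'n) set set" and \<mu> :: "nat list"
    and \<phi> :: "(int ^ 'n \<Rightarrow>\<^sub>0 int) set \<Rightarrow> int \<times> (nat \<Rightarrow> int)"
  assumes complete: "complete_fan Z" and factors: "invariant_factors \<mu>"
    and iso: "\<phi> \<in> iso (Cl Z) (grading_group \<mu>)"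
begin

definition deg :: "(int ^ 'n \<Rightarrow>\<^sub>0 int) \<Rightarrow> int" where
  "deg D = fst (\<phi> (div_class Z D))"

definition tor :: "(int ^ 'n \<Rightarrow>\<^sub>0 int) \<Rightarrow> nat \<Rightarrow> int" where
  "tor D = snd (\<phi> (div_class Z D))"

definition weight :: "int ^ 'n \<Rightarrow> int" where
  "weight v = deg (frag_of v)"

lemma rays_finite: "finite (rays Z)"
  using complete finite_rays by (auto simp: complete_fan_def)

lemma factor_ge_2: "i < length \<mu> \<Longrightarrow> 2 \<le> \<mu> ! i"
  using factors by (simp add: invariant_factors_def)

lemma carrier_factor: "i < length \<mu> \<Longrightarrow> carrier (integer_mod_group (\<mu> ! i)) = {0..<int (\<mu> ! i)}"
  using factor_ge_2[of i] by (simp add: carrier_integer_mod_group)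

lemma class_in_grading_group:
  "Poly_Mapping.keys D \<subseteq> rays Z \<Longrightarrow> \<phi> (div_class Z D) \<in> carrier (grading_group \<mu>)"
  using iso by (auto simp: iso_def hom_def carrier_Cl)

lemma tor_mem: "Poly_Mapping.keys D \<subseteq> rays Z \<Longrightarrow>
    tor D \<in> (\<Pi>\<^sub>E i\<in>{..<length \<mu>}. carrier (integer_mod_group (\<mu> ! i)))"
  using class_in_grading_group[of D] by (auto simp: grading_group_def tor_def mem_Times_iff)

lemma tor_bounds:
  assumes "Poly_Mapping.keys D \<subseteq> rays Z" "i < length \<mu>"
  shows "0 \<le> tor D i" "tor D i < int (\<mu> ! i)"
  using tor_mem[OF assms(1)] assms(2) carrier_factor[OF assms(2)] by (auto simp: PiE_iff)

lemma class_add: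
  assumes "Poly_Mapping.keys D \<subseteq> rays Z" "Poly_Mapping.keys D' \<subseteq> rays Z"
  shows "\<phi> (div_class Z (D + D')) = \<phi> (div_class Z D) \<otimes>\<^bsub>grading_group \<mu>\<^esub> \<phi> (div_class Z D')"
proof -
  have "div_class Z (D + D') = div_class Z D \<otimes>\<^bsub>Cl Z\<^esub> div_class Z D'"
    using hom_mult[OF div_class_hom[OF rays_finite], of D D'] assms by simp
  then show ?thesis using iso assms hom_mult[of \<phi> "Cl Z" "grading_group \<mu>"] by (auto simp: iso_def carrier_Cl)
qed

lemma deg_expand:
  assumes "Poly_Mapping.keys D \<subseteq> rays Z"
  shows "deg D = (\<Sum>v\<in>rays Z. Poly_Mapping.lookup D v * weight v)"
proof -
  have "[deg D = (\<Sum>v\<in>rays Z. Poly_Mapping.lookup D v * deg (frag_of v))] (mod 0)"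
    by (rule congruence_additive_expand[OF _ rays_finite assms])
      (simp add: deg_def class_add grading_group_def mult_DirProd')
  then show ?thesis by (simp add: weight_def)
qed

lemma tor_expand:
  assumes D: "Poly_Mapping.keys D \<subseteq> rays Z" and i: "i < length \<mu>"
  shows "[tor D i = (\<Sum>v\<in>rays Z. Poly_Mapping.lookup D v * tor (frag_of v) i)] (mod int (\<mu> ! i))"
  by (rule congruence_additive_expand[OF _ rays_finite D])
    (use i in \<open>simp add: tor_def class_add grading_group_def mult_DirProd'\<close>)

lemma tor_add:
  assumes "Poly_Mapping.keys D \<subseteq> rays Z" "Poly_Mapping.keys D' \<subseteq> rays Z" "i < length \<mu>"
  shows "[tor (D + D') i = tor D i + tor D' i] (mod int (\<mu> ! i))"
  using assms by (simp add: tor_def class_add grading_group_def mult_DirProd')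

lemma deg_cmul: "Poly_Mapping.keys D \<subseteq> rays Z \<Longrightarrow> deg (frag_cmul k D) = k * deg D"
  using deg_expand[of D] deg_expand[OF keys_cmul_subset, of D k]
  by (simp add: sum_distrib_left mult.assoc)

lemma tor_cmul:
  assumes D: "Poly_Mapping.keys D \<subseteq> rays Z" and i: "i < length \<mu>"
  shows "[tor (frag_cmul k D) i = k * tor D i] (mod int (\<mu> ! i))"
proof -
  have "[tor (frag_cmul k D) i =
      k * (\<Sum>v\<in>rays Z. Poly_Mapping.lookup D v * tor (frag_of v) i)] (mod int (\<mu> ! i))"
    using tor_expand[OF keys_cmul_subset[OF D] i, of k] by (simp add: sum_distrib_left mult.assoc)
  also have "[k * (\<Sum>v\<in>rays Z. Poly_Mapping.lookup D v * tor (frag_of v) i) = k * tor D i] (mod int (\<mu> ! i))"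
    using tor_expand[OF D i] by (intro cong_mult) (auto simp: cong_sym)
  finally show ?thesis .
qed

lemma tor_eqI:
  assumes "Poly_Mapping.keys D \<subseteq> rays Z" "Poly_Mapping.keys D' \<subseteq> rays Z" "i < length \<mu>"
    and "[tor D i = tor D' i] (mod int (\<mu> ! i))"
  shows "tor D i = tor D' i"
  using assms(4) tor_bounds[OF assms(1,3)] tor_bounds[OF assms(2,3)] by (simp add: cong_def)

lemma principal_iff:
  assumes D: "Poly_Mapping.keys D \<subseteq> rays Z" "Poly_Mapping.keys D' \<subseteq> rays Z"
  shows "principal_div Z (D - D') \<longleftrightarrow> deg D = deg D' \<and> (\<forall>i<length \<mu>. tor D i = tor D' i)"
proof -
  have "inj_on \<phi> (carrier (Cl Z))" using iso by (simp add: iso_def bij_betw_def)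
  moreover have "div_class Z D \<in> carrier (Cl Z)" "div_class Z D' \<in> carrier (Cl Z)"
    using D by (simp_all add: carrier_Cl)
  ultimately have "principal_div Z (D - D') \<longleftrightarrow> \<phi> (div_class Z D) = \<phi> (div_class Z D')"
    unfolding div_class_eq_iff[OF rays_finite, symmetric] by (rule inj_on_eq_iff[symmetric])
  also have "\<dots> \<longleftrightarrow> deg D = deg D' \<and> tor D = tor D'"
    by (simp add: deg_def tor_def prod_eq_iff)
  also have "tor D = tor D' \<longleftrightarrow> (\<forall>i<length \<mu>. tor D i = tor D' i)"
    using PiE_ext[OF tor_mem[OF D(1)] tor_mem[OF D(2)]] by (metis lessThan_iff)
  finally show ?thesis .
qed

lemma deg_tor_surj:
  assumes "t \<in> (\<Pi>\<^sub>E i\<in>{..<length \<mu>}. carrier (integer_mod_group (\<mu> ! i)))"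
  obtains D where "Poly_Mapping.keys D \<subseteq> rays Z" "deg D = d" "tor D = t"
proof -
  have "(d, t) \<in> carrier (grading_group \<mu>)" using assms by (simp add: grading_group_def)
  then have "(d, t) \<in> \<phi> ` carrier (Cl Z)" using iso by (auto simp: iso_def bij_betw_def)
  then obtain D where "Poly_Mapping.keys D \<subseteq> rays Z" "\<phi> (div_class Z D) = (d, t)"
    by (auto simp: carrier_Cl)
  then show thesis by (intro that[of D]) (simp_all add: deg_def tor_def)
qed

lemma tor_zero:
  assumes "i < length \<mu>"
  shows "tor 0 i = 0"
  using tor_expand[of 0 i] tor_bounds[of 0 i] assms by (simp add: cong_def)

lemma deg_zero: "deg 0 = 0"
  by (simp add: deg_expand)

lemma zero_torsion_mem: "(\<lambda>i\<in>{..<length \<mu>}. 0) \<in> (\<Pi>\<^sub>E i\<in>{..<length \<mu>}. carrier (integer_mod_group (\<mu> ! i)))"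
  by auto

lemma degree_one_divisor: obtains D where "Poly_Mapping.keys D \<subseteq> rays Z" "deg D = 1"
  using deg_tor_surj[OF zero_torsion_mem, of 1] by metis

lemma some_weight_nonzero: "\<exists>u\<in>rays Z. weight u \<noteq> 0"
proof (rule ccontr)
  assume "\<not> ?thesis"
  moreover obtain D where "Poly_Mapping.keys D \<subseteq> rays Z" "deg D = 1" using degree_one_divisor .
  ultimately show False by (simp add: deg_expand)
qed

lemma weight_relation: "(\<Sum>v\<in>rays Z. scalar_product m v * weight v) = 0"
proof -
  have keys: "Poly_Mapping.keys (char_div Z m) \<subseteq> rays Z" by (rule keys_char_div[OF rays_finite])
  have "principal_div Z (char_div Z m - 0)" by simp
  then have "deg (char_div Z m) = 0" using principal_iff[OF keys, of 0] deg_zero by simp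
  then show ?thesis by (simp add: deg_expand[OF keys] lookup_char_div[OF rays_finite])
qed

lemma degree_zero_torsion:
  "\<exists>N>0. \<forall>D. Poly_Mapping.keys D \<subseteq> rays Z \<longrightarrow>
     (\<Sum>v\<in>rays Z. Poly_Mapping.lookup D v * weight v) = 0 \<longrightarrow> principal_div Z (frag_cmul N D)"
proof (intro exI conjI allI impI)
  \<comment> \<open>The product of the invariant factors annihilates the torsion part.\<close>
  let ?N = "int (prod_list \<mu>)"
  have "0 \<notin> set \<mu>"
  proof
    assume "0 \<in> set \<mu>"
    then obtain i where "i < length \<mu>" "\<mu> ! i = 0" by (auto simp: in_set_conv_nth)
    then show False using factor_ge_2[of i] by simp
  qed
  then show "0 < ?N" by (simp add: prod_list_zero_iff zero_less_iff_neq_zero)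
  fix D assume D: "Poly_Mapping.keys D \<subseteq> rays Z"
    and deg0: "(\<Sum>v\<in>rays Z. Poly_Mapping.lookup D v * weight v) = 0"
  have keys: "Poly_Mapping.keys (frag_cmul ?N D) \<subseteq> rays Z" using D by (rule keys_cmul_subset)
  have "deg (frag_cmul ?N D) = 0" using deg0 D by (simp add: deg_cmul deg_expand)
  moreover have "tor (frag_cmul ?N D) i = tor 0 i" if i: "i < length \<mu>" for i
  proof (rule tor_eqI[OF keys _ i])
    have "[tor (frag_cmul ?N D) i = ?N * tor D i] (mod int (\<mu> ! i))" by (rule tor_cmul[OF D i])
    also have "[?N * tor D i = 0] (mod int (\<mu> ! i))"
      unfolding cong_0_iff using i by (intro dvd_mult2) (simp add: prod_list_dvd)
    finally show "[tor (frag_cmul ?N D) i = tor 0 i] (mod int (\<mu> ! i))"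
      unfolding tor_zero[OF i] .
  qed simp
  ultimately have "principal_div Z (frag_cmul ?N D - 0)"
    using principal_iff[OF keys, of 0] deg_zero by simp
  then show "principal_div Z (frag_cmul ?N D)" by simp
qed

end

locale positive_grading = complete_fan_grading Z \<mu> \<phi>
  for Z :: "(real ^ 'n) set set" and \<mu> \<phi> +
  assumes some_weight_pos: "\<exists>u\<in>rays Z. 0 < weight u"

sublocale positive_grading \<subseteq> weighted_complete_fan Z weight
  using complete weight_relation degree_zero_torsion some_weight_pos
  by unfold_locales

lemma negate_degree_iso:
  "(\<lambda>(x, t). (- x, t)) \<in> iso (grading_group \<mu>) (grading_group \<mu>)"
proof -
  have "uminus \<in> iso integer_group integer_group"
    by (auto simp: iso_def hom_def bij_betw_def)
  then show ?thesis
    unfolding grading_group_def by (subst iso_paired2) (simp_all add: iso_set_refl)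
qed

text \<open>
  The weights have a common sign, but which one depends on the isomorphism; if it is negative, the
  free summand has to be reflected.
\<close>

lemma positive_grading_exists:
  assumes "complete_fan Z" "invariant_factors \<mu>" "Cl Z \<cong> grading_group \<mu>"
  obtains \<phi> where "positive_grading Z \<mu> \<phi>"
proof -
  obtain \<phi> where "\<phi> \<in> iso (Cl Z) (grading_group \<mu>)" using assms by (auto simp: is_iso_def)
  then interpret \<phi>: complete_fan_grading Z \<mu> \<phi> using assms by unfold_locales
  let ?\<psi> = "(\<lambda>(x, t). (- x, t)) \<circ> \<phi>"
  have "?\<psi> \<in> iso (Cl Z) (grading_group \<mu>)"
    using \<phi>.iso negate_degree_iso by (rule iso_set_trans)
  then interpret \<psi>: complete_fan_grading Z \<mu> ?\<psi> using assms by unfold_locales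
  have neg: "\<psi>.weight u = - \<phi>.weight u" for u
    unfolding \<psi>.weight_def \<phi>.weight_def \<psi>.deg_def \<phi>.deg_def by (simp add: case_prod_unfold)
  obtain u where u: "u \<in> rays Z" "\<phi>.weight u \<noteq> 0" using \<phi>.some_weight_nonzero by blast
  show thesis
  proof (cases "0 < \<phi>.weight u")
    case True
    then have "positive_grading Z \<mu> \<phi>" using u by unfold_locales blast
    then show thesis by (rule that)
  next
    case False
    then have "0 < \<psi>.weight u" using u by (simp add: neg)
    then have "positive_grading Z \<mu> ?\<psi>" using u by unfold_locales blast
    then show thesis by (rule that)
  qed
qed

section \<open>Nef-partitions\<close>

text \<open>A block \<open>{v}\<close> would have the class of \<open>D\<^sub>v\<close>.\<close>

lemma nef_block_card_ge_2:
  assumes fin: "finite (rays Z)" and nef: "nef_partition Z P" and B: "B \<in> P"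
  shows "2 \<le> card B"
proof -
  have sub: "B \<subseteq> rays Z" and "B \<noteq> {}"
    using nef B by (auto simp: nef_partition_def partition_on_def)
  then have "card B \<noteq> 0" using fin finite_subset by fastforce
  moreover have "card B \<noteq> 1"
  proof
    assume "card B = 1"
    then obtain v where v: "B = {v}" by (auto simp: card_1_singleton_iff)
    then have "block_class Z B = prime_class Z v"
      using block_class_eq[OF fin sub] by (simp add: prime_class_def)
    then show False using nef B sub v by (auto simp: nef_partition_def)
  qed
  ultimately show ?thesis by linarith
qed

lemma card_rays_eq_sum_blocks:
  assumes "finite (rays Z)" "nef_partition Z P"
  shows "finite P" "card (rays Z) = (\<Sum>B\<in>P. card B)"
proof -
  have P: "\<Union>P = rays Z" "disjoint P" using assms by (auto simp: nef_partition_def partition_on_def)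
  then show "finite P" using assms finite_UnionD by metis
  have "finite B" if "B \<in> P" for B using that P assms finite_subset[of B "rays Z"] by blast
  then have "card (\<Union>P) = sum card P" using P(2) by (intro card_Union_disjoint) auto
  then show "card (rays Z) = (\<Sum>B\<in>P. card B)" using P by simp
qed

lemma nef_block_subset: "nef_partition Z P \<Longrightarrow> B \<in> P \<Longrightarrow> B \<subseteq> rays Z"
  by (auto simp: nef_partition_def partition_on_def)

lemma nef_block_exists: "nef_partition Z P \<Longrightarrow> v \<in> rays Z \<Longrightarrow> \<exists>B\<in>P. v \<in> B"
  unfolding nef_partition_def partition_on_def by blast

lemma nef_card_le:
  assumes "finite (rays Z)" "nef_partition Z P"
  shows "2 * card P \<le> card (rays Z)"
proof -
  have "(\<Sum>B\<in>P. 2) \<le> (\<Sum>B\<in>P. card B)"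
    using nef_block_card_ge_2[OF assms] by (intro sum_mono) auto
  then show ?thesis using card_rays_eq_sum_blocks(2)[OF assms] by simp
qed

lemma nef_blocks_are_pairs:
  assumes fin: "finite (rays Z)" and nef: "nef_partition Z P"
    and le: "card (rays Z) \<le> 2 * card P"
  shows "\<forall>B\<in>P. card B = 2"
proof (intro ballI, rule ccontr)
  fix B assume B: "B \<in> P" and "card B \<noteq> 2"
  then have "2 < card B" using nef_block_card_ge_2[OF fin nef B] by simp
  then have "(\<Sum>B\<in>P. 2) < (\<Sum>B\<in>P. card B)"
    using nef_block_card_ge_2[OF fin nef] B card_rays_eq_sum_blocks(1)[OF fin nef]
    by (intro sum_strict_mono_ex1) auto
  then show False using card_rays_eq_sum_blocks(2)[OF fin nef] le by simp
qed

lemma sum_two_halves: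
  fixes g :: "nat \<Rightarrow> 'a::comm_monoid_add"
  shows "(\<Sum>k\<in>{0..<2 * s}. g k) = (\<Sum>j<s. g j + g (s + j))"
proof -
  have "(\<Sum>k\<in>{0..<s+n}. g k) = (\<Sum>j<s. g j) + (\<Sum>j<n. g (s + j))" for n
    by (induction n) (simp_all add: add.assoc atLeast0LessThan)
  from this[of s] show ?thesis by (simp add: sum.distrib mult_2)
qed

text \<open>
  The numbering places the two members of a block in columns \<open>j\<close> and \<open>s + j\<close>, as in the two
  halves of the degree matrix.
\<close>

lemma enumerate_pairs:
  assumes fin: "finite R" and P: "partition_on R P" and card2: "\<forall>B\<in>P. card B = 2"
  obtains \<rho> where "bij_betw \<rho> {0..<2 * card P} R"
    "\<And>j. j < card P \<Longrightarrow> {\<rho> j, \<rho> (card P + j)} \<in> P \<and> \<rho> j \<noteq> \<rho> (card P + j)"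
proof -
  have U: "\<Union>P = R" "disjoint P" using P by (auto simp: partition_on_def)
  have "finite P" using U fin finite_UnionD by metis
  then obtain h where h: "bij_betw h {0..<card P} P" using ex_bij_betw_nat_finite by blast
  have "\<forall>B\<in>P. \<exists>a b. B = {a, b} \<and> a \<noteq> b" using card2 by (metis card_2_iff)
  then obtain a b where ab: "\<And>B. B \<in> P \<Longrightarrow> B = {a B, b B} \<and> a B \<noteq> b B" by metis
  define \<rho> where "\<rho> k = (if k < card P then a (h k) else b (h (k - card P)))" for k
  have hP: "h j \<in> P" if "j < card P" for j using h that by (auto simp: bij_betw_def)
  have pair: "{\<rho> j, \<rho> (card P + j)} = h j" "\<rho> j \<noteq> \<rho> (card P + j)" if "j < card P" for j
    using ab[OF hP[OF that]] that by (auto simp: \<rho>_def)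
  have "R \<subseteq> \<rho> ` {0..<2 * card P}"
  proof
    fix v assume "v \<in> R"
    then obtain B where B: "B \<in> P" "v \<in> B" using U by auto
    then obtain j where j: "j < card P" "B = h j"
      using bij_betw_imp_surj_on[OF h] by (metis atLeastLessThan_iff imageE)
    then have "v = \<rho> j \<or> v = \<rho> (card P + j)" using pair(1)[OF j(1)] B by blast
    then show "v \<in> \<rho> ` {0..<2 * card P}" using j by auto
  qed
  moreover have "\<rho> ` {0..<2 * card P} \<subseteq> R"
  proof
    fix v assume "v \<in> \<rho> ` {0..<2 * card P}"
    then obtain k where k: "k < 2 * card P" "v = \<rho> k" by auto
    define j where "j = (if k < card P then k else k - card P)"
    have "j < card P" "k = j \<or> k = card P + j" using k by (auto simp: j_def)
    then have "v \<in> h j" "h j \<in> P" using pair(1)[of j] hP k by auto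
    then show "v \<in> R" using U by blast
  qed
  ultimately have im: "\<rho> ` {0..<2 * card P} = R" by auto
  have "card R = (\<Sum>B\<in>P. card B)"
    using U card2 fin by (metis card_Union_disjoint finite_subset Union_upper)
  then have "card R = 2 * card P" using card2 by simp
  then have "inj_on \<rho> {0..<2 * card P}" using im by (intro eq_card_imp_inj_on) auto
  then have "bij_betw \<rho> {0..<2 * card P} R" using im by (simp add: bij_betw_def)
  then show thesis using pair hP by (intro that) auto
qed

context positive_grading
begin

text \<open>
  The Cartier class of the block is a multiple \<open>k[D\<^sub>u]\<close> for every ray \<open>u\<close>. Positivity of the
  weights gives \<open>k > 0\<close>, and \<open>k = 1\<close> is what the definition of a nef-partition excludes.
\<close>

lemma nef_pair_class:
  assumes nef: "nef_partition Z P" and ab: "{a, b} \<in> P" "a \<noteq> b" and u: "u \<in> rays Z"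
  obtains k where "2 \<le> k" "weight a + weight b = k * weight u"
    "principal_div Z (frag_of a + frag_of b - frag_cmul k (frag_of u))"
proof -
  let ?E = "frag_of a + frag_of b"
  have sub: "{a, b} \<subseteq> rays Z" by (rule nef_block_subset[OF nef ab(1)])
  have keysE: "Poly_Mapping.keys ?E \<subseteq> rays Z" using sub by (intro keys_add_subset) auto
  have keysu: "Poly_Mapping.keys (frag_cmul k (frag_of u)) \<subseteq> rays Z" for k
    using u by (intro keys_cmul_subset) simp
  have cl: "block_class Z {a, b} = div_class Z ?E" using block_class_eq[OF fin sub] ab by simp
  then obtain D where D: "cartier Z D" "div_class Z ?E = div_class Z D"
    using nef ab unfolding nef_partition_def Pic_def by auto
  obtain k where k: "principal_div Z (D - frag_cmul k (frag_of u))" using D(1) u cartier_iff by blast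
  have "principal_div Z (?E - D)" using D(2) div_class_eq_iff[OF fin] by blast
  then have Ek: "principal_div Z (?E - frag_cmul k (frag_of u))" using k by (rule principal_trans[OF fin])
  then have "deg ?E = deg (frag_cmul k (frag_of u))" using principal_iff[OF keysE keysu] by blast
  moreover have "deg ?E = weight a + weight b"
    using sub class_add[of "frag_of a" "frag_of b"]
    by (simp add: deg_def weight_def grading_group_def mult_DirProd')
  ultimately have eq: "weight a + weight b = k * weight u"
    using u by (simp add: deg_cmul weight_def)
  have "0 < k * weight u" using eq weight_pos sub by (metis add_pos_pos insert_subset)
  then have "0 < k" using weight_pos[OF u] by (simp add: zero_less_mult_iff)
  moreover have "k \<noteq> 1"
  proof
    assume "k = 1"
    then have "block_class Z {a, b} = prime_class Z u"
      using Ek by (simp add: cl prime_class_def div_class_eq_iff[OF fin])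
    then show False using nef ab u by (auto simp: nef_partition_def)
  qed
  ultimately show thesis using eq Ek by (intro that) auto
qed

text \<open>
  Every ray \<open>u\<close> satisfies \<open>2 w(u) \<le> w(a) + w(b)\<close> for every block \<open>{a, b}\<close>. Taking \<open>u = b\<close> gives
  \<open>w(b) \<le> w(a)\<close>, so that \<open>w(a)\<close> is maximal. As every ray belongs to a block, all weights agree,
  and they are one because the class group has elements of degree one.
\<close>

lemma nef_pairs_weight_one:
  assumes nef: "nef_partition Z P" and card2: "\<forall>B\<in>P. card B = 2" and u: "u \<in> rays Z"
  shows "weight u = 1"
proof -
  have block: "\<exists>b. {v, b} \<in> P \<and> v \<noteq> b" if v: "v \<in> rays Z" for v
  proof -
    obtain B where B: "B \<in> P" "v \<in> B" using nef_block_exists[OF nef v] by blast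
    then have "card B = 2" using card2 by blast
    then obtain a b where "B = {a, b}" "a \<noteq> b" by (auto simp: card_2_iff)
    then show ?thesis using B by (metis insert_commute insertE singletonD)
  qed
  have bound: "2 * weight x \<le> weight a + weight b"
    if ab: "{a, b} \<in> P" "a \<noteq> b" and x: "x \<in> rays Z" for a b x
  proof -
    obtain k where k: "2 \<le> k" "weight a + weight b = k * weight x"
      using nef_pair_class[OF nef ab x] by metis
    have "2 * weight x \<le> k * weight x" using k weight_pos[OF x] by (intro mult_right_mono) auto
    then show ?thesis using k by simp
  qed
  have max: "weight x \<le> weight v" if v: "v \<in> rays Z" and x: "x \<in> rays Z" for v x
  proof -
    obtain b where b: "{v, b} \<in> P" "v \<noteq> b" using block v by blast
    then have "b \<in> rays Z" using nef_block_subset[OF nef] by blast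
    then show ?thesis using bound[OF b] x by (smt (verit))
  qed
  have const: "weight v = weight u" if "v \<in> rays Z" for v
    using max[OF that u] max[OF u that] by simp
  obtain D where "Poly_Mapping.keys D \<subseteq> rays Z" "deg D = 1" using degree_one_divisor .
  then have "1 = (\<Sum>v\<in>rays Z. Poly_Mapping.lookup D v) * weight u"
    using const by (simp add: deg_expand sum_distrib_right)
  then have "weight u dvd 1" by (metis dvd_triv_right)
  then show ?thesis using weight_pos[OF u] by simp
qed

text \<open>All weights being one, the multiple \<open>k\<close> above is the degree \<open>2\<close> of the block.\<close>

lemma nef_pair_twice_class:
  assumes nef: "nef_partition Z P" and card2: "\<forall>B\<in>P. card B = 2"
    and ab: "{a, b} \<in> P" "a \<noteq> b" and u: "u \<in> rays Z"
  shows "principal_div Z (frag_of a + frag_of b - frag_cmul 2 (frag_of u))"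
proof -
  have "a \<in> rays Z" "b \<in> rays Z" using nef_block_subset[OF nef ab(1)] by simp_all
  moreover obtain k where "weight a + weight b = k * weight u"
    "principal_div Z (frag_of a + frag_of b - frag_cmul k (frag_of u))"
    using nef_pair_class[OF nef ab u] by metis
  moreover note nef_pairs_weight_one[OF nef card2]
  ultimately show ?thesis using u by simp
qed

text \<open>The relation \<open>[D\<^sub>a] + [D\<^sub>b] = 2[D\<^sub>u]\<close> applies to \<open>u = b\<close>.\<close>

lemma nef_pair_equal_classes:
  assumes nef: "nef_partition Z P" and card2: "\<forall>B\<in>P. card B = 2"
    and ab: "{a, b} \<in> P" "a \<noteq> b"
  shows "principal_div Z (frag_of a - frag_of b)"
proof -
  have "b \<in> rays Z" using nef_block_subset[OF nef ab(1)] by simp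
  then have "principal_div Z (frag_of a + frag_of b - frag_cmul 2 (frag_of b))"
    using nef_pair_twice_class[OF assms] by simp
  moreover have "frag_of a + frag_of b - frag_cmul 2 (frag_of b) = frag_of a - frag_of b"
    by (rule poly_mapping_eqI) (simp add: lookup_add lookup_minus)
  ultimately show ?thesis by simp
qed

text \<open>
  If all weights are one, a divisor of degree zero is an integral combination of differences
  \<open>D\<^sub>v - D\<^sub>u\<close>, whose doubles are principal.
\<close>

lemma nef_pairs_degree_zero_2_torsion:
  assumes nef: "nef_partition Z P" and card2: "\<forall>B\<in>P. card B = 2"
    and D: "Poly_Mapping.keys D \<subseteq> rays Z" "deg D = 0"
  shows "principal_div Z (frag_cmul 2 D)"
proof -
  obtain u where u: "u \<in> rays Z" using some_weight_pos by blast
  obtain B where B: "B \<in> P" using nef_block_exists[OF nef u] by blast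
  then have "card B = 2" using card2 by blast
  then obtain a b where ab: "{a, b} \<in> P" "a \<noteq> b" using B by (auto simp: card_2_iff)
  have diff: "principal_div Z (frag_cmul 2 (frag_of v) - frag_cmul 2 (frag_of u))"
    if v: "v \<in> rays Z" for v
    using principal_sym[OF fin nef_pair_twice_class[OF nef card2 ab v]]
      nef_pair_twice_class[OF nef card2 ab u] by (rule principal_trans[OF fin])
  have sum0: "(\<Sum>v\<in>rays Z. Poly_Mapping.lookup D v) = 0"
    using D nef_pairs_weight_one[OF nef card2] by (simp add: deg_expand)
  have "frag_cmul 2 D = (\<Sum>v\<in>rays Z. frag_cmul (Poly_Mapping.lookup D v)
      (frag_cmul 2 (frag_of v) - frag_cmul 2 (frag_of u)))"
    (is "_ = ?S")
  proof (rule poly_mapping_eqI)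
    fix x
    have "Poly_Mapping.lookup ?S x =
        (\<Sum>v\<in>rays Z. (if v = x then 2 * Poly_Mapping.lookup D x else 0)
          - Poly_Mapping.lookup D v * (if x = u then 2 else 0))"
      unfolding lookup_sum by (intro sum.cong) (auto simp: lookup_minus right_diff_distrib)
    also have "\<dots> = (if x \<in> rays Z then 2 * Poly_Mapping.lookup D x else 0)"
      using fin sum0 by (simp add: sum_subtractf sum_distrib_right[symmetric])
    also have "\<dots> = 2 * Poly_Mapping.lookup D x"
    proof (cases "x \<in> rays Z")
      case False
      then have "x \<notin> Poly_Mapping.keys D" using D by blast
      then have "Poly_Mapping.lookup D x = 0" by (rule not_in_keys_iff_lookup_eq_zero[THEN iffD1])
      then show ?thesis by simp
    qed simp
    finally show "Poly_Mapping.lookup (frag_cmul 2 D) x = Poly_Mapping.lookup ?S x" by simp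
  qed
  moreover have "principal_div Z ?S"
    using diff by (intro principal_sum[OF fin] principal_cmul[OF fin]) auto
  ultimately show ?thesis by simp
qed

text \<open>The generator of the summand \<open>\<int>/\<mu>\<^sub>i\<int>\<close> has degree zero, so that its double vanishes.\<close>

lemma nef_pairs_factors:
  assumes nef: "nef_partition Z P" and card2: "\<forall>B\<in>P. card B = 2"
    and i: "i < length \<mu>"
  shows "\<mu> ! i = 2"
proof -
  define t where "t = (\<lambda>j\<in>{..<length \<mu>}. if j = i then 1 else 0 :: int)"
  have "t \<in> (\<Pi>\<^sub>E j\<in>{..<length \<mu>}. carrier (integer_mod_group (\<mu> ! j)))"
    using factor_ge_2[OF i] by (auto simp: t_def)
  then obtain D where D: "Poly_Mapping.keys D \<subseteq> rays Z" "deg D = 0" "tor D = t"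
    using deg_tor_surj by metis
  have "principal_div Z (frag_cmul 2 D - 0)"
    using nef_pairs_degree_zero_2_torsion[OF nef card2] D by simp
  moreover have "Poly_Mapping.keys (frag_cmul 2 D) \<subseteq> rays Z" using D(1) by (rule keys_cmul_subset)
  ultimately have "tor (frag_cmul 2 D) i = 0"
    using principal_iff[of "frag_cmul 2 D" 0] i tor_zero[OF i] by simp
  then have "[0 = 2] (mod int (\<mu> ! i))" using tor_cmul[OF D(1) i, of 2] D(3) i by (simp add: t_def)
  then have "int (\<mu> ! i) dvd 2" by (simp add: cong_iff_dvd_diff)
  then have "\<mu> ! i \<le> 2" using zdvd_imp_le[of "int (\<mu> ! i)" 2] by simp
  then show ?thesis using factor_ge_2[OF i] by simp
qed

text \<open>
  A torsion element \<open>y\<close> is the torsion part of a divisor of degree one. Expanding that divisor into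
  prime divisors expresses \<open>y\<close> by the columns, and as all weights are one, the coefficients add up
  to the degree.
\<close>

lemma columns_affinely_span:
  assumes s: "bij_betw \<rho> {0..<2 * s} (rays Z)"
    and weight: "\<And>u. u \<in> rays Z \<Longrightarrow> weight u = 1"
    and factors2: "\<And>i. i < length \<mu> \<Longrightarrow> \<mu> ! i = 2"
    and A: "\<And>i j. i < length \<mu> \<Longrightarrow> j < s \<Longrightarrow>
      tor (frag_of (\<rho> j)) i = A i j \<and> tor (frag_of (\<rho> (s + j))) i = A i j"
  shows "affine_span2 (length \<mu>) s A =
    carrier (product_group {..<length \<mu>} (\<lambda>i. integer_mod_group 2))"
proof
  show "affine_span2 (length \<mu>) s A \<subseteq> carrier (product_group {..<length \<mu>} (\<lambda>i. integer_mod_group 2))"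
  proof
    fix y assume "y \<in> affine_span2 (length \<mu>) s A"
    then obtain c where y: "y = (\<lambda>i\<in>{..<length \<mu>}. (\<Sum>j<s. c j * A i j) mod 2)"
      unfolding affine_span2_def by blast
    show "y \<in> carrier (product_group {..<length \<mu>} (\<lambda>i. integer_mod_group 2))"
      unfolding y carrier_product_group restrict_PiE_iff by (simp add: carrier_integer_mod_group)
  qed
  show "carrier (product_group {..<length \<mu>} (\<lambda>i. integer_mod_group 2)) \<subseteq> affine_span2 (length \<mu>) s A"
  proof
    fix y assume "y \<in> carrier (product_group {..<length \<mu>} (\<lambda>i. integer_mod_group 2))"
    then have y: "y \<in> (\<Pi>\<^sub>E i\<in>{..<length \<mu>}. carrier (integer_mod_group 2))" by simp
    also have "\<dots> = (\<Pi>\<^sub>E i\<in>{..<length \<mu>}. carrier (integer_mod_group (\<mu> ! i)))"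
      using factors2 by (intro PiE_cong) auto
    finally obtain D where D: "Poly_Mapping.keys D \<subseteq> rays Z" "deg D = 1" "tor D = y"
      using deg_tor_surj by metis
    \<comment> \<open>The rays \<open>\<rho> j\<close> and \<open>\<rho> (s + j)\<close> contribute the same column.\<close>
    define c where "c j = Poly_Mapping.lookup D (\<rho> j) + Poly_Mapping.lookup D (\<rho> (s + j))" for j
    have reindex: "(\<Sum>v\<in>rays Z. g v) = (\<Sum>j<s. g (\<rho> j) + g (\<rho> (s + j)))" for g :: "int ^ 'n \<Rightarrow> int"
      using sum.reindex_bij_betw[OF s, of g] sum_two_halves[of "\<lambda>k. g (\<rho> k)" s] by simp
    have "(\<Sum>v\<in>rays Z. Poly_Mapping.lookup D v) = 1"
      using D weight by (simp add: deg_expand)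
    then have c1: "(\<Sum>j<s. c j) = 1" by (simp add: reindex c_def)
    have "y i = (\<Sum>j<s. c j * A i j) mod 2" if i: "i < length \<mu>" for i
    proof -
      have "(\<Sum>v\<in>rays Z. Poly_Mapping.lookup D v * tor (frag_of v) i) = (\<Sum>j<s. c j * A i j)"
        unfolding reindex by (intro sum.cong) (auto simp: A[OF i] c_def distrib_right)
      then have "[y i = (\<Sum>j<s. c j * A i j)] (mod 2)"
        using tor_expand[OF D(1) i] D(3) factors2[OF i] by simp
      moreover have "0 \<le> y i" "y i < 2" using tor_bounds[OF D(1) i] D(3) factors2[OF i] by auto
      ultimately show ?thesis by (simp add: cong_def)
    qed
    then have "y = (\<lambda>i\<in>{..<length \<mu>}. (\<Sum>j<s. c j * A i j) mod 2)"
      using y by (intro extensionalityI[of y "{..<length \<mu>}"]) (auto simp: PiE_iff)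
    then show "y \<in> affine_span2 (length \<mu>) s A"
      unfolding affine_span2_def using c1 by (intro CollectI exI[of _ c]) simp
  qed
qed

lemma nef_pairs_degree_matrix:
  assumes nef: "nef_partition Z P" and dim: "CARD('n) + 1 = 2 * card P"
  shows "\<exists>Q A. degree_matrix Z \<mu> Q \<and> mat2 (length \<mu>) (card P) A \<and>
    (\<forall>j<card P. Q j = (1, col (length \<mu>) A j) \<and> Q (card P + j) = (1, col (length \<mu>) A j)) \<and>
    affine_span2 (length \<mu>) (card P) A =
      carrier (product_group {..<length \<mu>} (\<lambda>i. integer_mod_group 2))"
proof -
  let ?s = "card P"
  have "card (rays Z) \<le> 2 * ?s" using card_rays_le dim by simp
  note card2 = nef_blocks_are_pairs[OF fin nef this]
  note weight1 = nef_pairs_weight_one[OF nef card2]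
  note factors2 = nef_pairs_factors[OF nef card2]
  have P: "partition_on (rays Z) P" using nef by (simp add: nef_partition_def)
  obtain \<rho> where \<rho>: "bij_betw \<rho> {0..<2 * ?s} (rays Z)"
    and pairs: "\<And>j. j < ?s \<Longrightarrow> {\<rho> j, \<rho> (?s + j)} \<in> P \<and> \<rho> j \<noteq> \<rho> (?s + j)"
    using enumerate_pairs[OF fin P card2] by metis
  have indices: "{0..CARD('n)} = {0..<2 * ?s}" using dim by auto
  have ray: "\<rho> k \<in> rays Z" if "k < 2 * ?s" for k using \<rho> that by (auto simp: bij_betw_def)
  define Q where "Q k = \<phi> (prime_class Z (\<rho> k))" for k
  define A where "A i j = tor (frag_of (\<rho> j)) i" for i j
  have Q: "Q k = (weight (\<rho> k), tor (frag_of (\<rho> k)))" for k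
    by (simp add: Q_def weight_def deg_def tor_def prime_class_def)
  have same: "tor (frag_of (\<rho> (?s + j))) i = A i j" if "j < ?s" "i < length \<mu>" for i j
    using nef_pair_equal_classes[OF nef card2, of "\<rho> j" "\<rho> (?s + j)"] pairs[OF that(1)] ray that
      principal_iff[of "frag_of (\<rho> j)" "frag_of (\<rho> (?s + j))"]
    by (simp add: A_def)
  have col: "tor (frag_of (\<rho> k)) = col (length \<mu>) A j"
    if "j < ?s" "k = j \<or> k = ?s + j" for j k
  proof (rule extensionalityI[of _ "{..<length \<mu>}"])
    have "k < 2 * ?s" using that by auto
    then show "tor (frag_of (\<rho> k)) \<in> extensional {..<length \<mu>}"
      using tor_mem[of "frag_of (\<rho> k)"] ray by (auto simp: PiE_iff)
    fix i assume "i \<in> {..<length \<mu>}"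
    then show "tor (frag_of (\<rho> k)) i = col (length \<mu>) A j i"
      using that same[of j i] by (auto simp: col_def A_def)
  qed (simp add: col_def)
  have "degree_matrix Z \<mu> Q"
    unfolding degree_matrix_def
  proof (intro conjI bexI[OF _ iso] exI[of _ \<rho>])
    show "bij_betw \<rho> {0..CARD('n)} (rays Z)" using \<rho> by (simp only: indices)
    show "\<forall>i\<in>{0..CARD('n)}. Q i = \<phi> (prime_class Z (\<rho> i))" by (simp add: Q_def)
    have fst1: "fst (Q k) = 1" if "k \<le> CARD('n)" for k
      using that dim ray[of k] by (simp add: Q weight1)
    show "1 \<le> fst (Q 0)" by (simp add: fst1)
    show "\<forall>i j. i \<le> j \<and> j \<le> CARD('n) \<longrightarrow> fst (Q i) \<le> fst (Q j)" by (simp add: fst1)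
  qed
  moreover have "mat2 (length \<mu>) ?s A"
    unfolding mat2_def
  proof (intro allI impI)
    fix i j assume ij: "i < length \<mu>" "j < ?s"
    then have "Poly_Mapping.keys (frag_of (\<rho> j)) \<subseteq> rays Z" using ray by simp
    from tor_bounds[OF this ij(1)] show "A i j \<in> carrier (integer_mod_group 2)"
      using factors2[OF ij(1)] by (simp add: A_def carrier_integer_mod_group)
  qed
  moreover have "Q j = (1, col (length \<mu>) A j) \<and> Q (?s + j) = (1, col (length \<mu>) A j)" if "j < ?s" for j
    using that ray col[of j] by (simp add: Q weight1)
  moreover have "affine_span2 (length \<mu>) ?s A =
      carrier (product_group {..<length \<mu>} (\<lambda>i. integer_mod_group 2))"
    using same by (intro columns_affinely_span[OF \<rho> weight1 factors2]) (auto simp: A_def)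
  ultimately show ?thesis by blast
qed

text \<open>Both sides have degree two, and doubling kills the torsion part.\<close>

lemma pair_class_if_equal_columns:
  assumes a: "a \<in> rays Z" "weight a = 1" and b: "b \<in> rays Z" "weight b = 1"
    and u: "u \<in> rays Z" "weight u = 1"
    and factors2: "\<And>i. i < length \<mu> \<Longrightarrow> \<mu> ! i = 2"
    and eq: "\<And>i. i < length \<mu> \<Longrightarrow> tor (frag_of a) i = tor (frag_of b) i"
  shows "principal_div Z (frag_of a + frag_of b - frag_cmul 2 (frag_of u))"
proof -
  have keys: "Poly_Mapping.keys (frag_of a + frag_of b) \<subseteq> rays Z"
    "Poly_Mapping.keys (frag_cmul 2 (frag_of u)) \<subseteq> rays Z"
    using a b u by (simp_all add: keys_add_subset keys_cmul_subset)
  have "deg (frag_of a + frag_of b) = deg (frag_cmul 2 (frag_of u))"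
    using a b u class_add[of "frag_of a" "frag_of b"]
    by (simp add: deg_cmul) (simp add: deg_def weight_def grading_group_def mult_DirProd')
  moreover have "tor (frag_of a + frag_of b) i = tor (frag_cmul 2 (frag_of u)) i"
    if i: "i < length \<mu>" for i
  proof (rule tor_eqI[OF keys i])
    have "[tor (frag_of a + frag_of b) i = 2 * tor (frag_of a) i] (mod 2)"
      using tor_add[of "frag_of a" "frag_of b" i] a b i eq[OF i] factors2[OF i] by simp
    moreover have "[tor (frag_cmul 2 (frag_of u)) i = 2 * tor (frag_of u) i] (mod 2)"
      using tor_cmul[of "frag_of u" i 2] u i factors2[OF i] by simp
    ultimately show "[tor (frag_of a + frag_of b) i = tor (frag_cmul 2 (frag_of u)) i] (mod int (\<mu> ! i))"
      using factors2[OF i] by (simp add: cong_def)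
  qed
  ultimately show ?thesis using principal_iff[OF keys] by blast
qed

text \<open>
  The class of a pair of equal columns is \<open>2[D\<^sub>u]\<close> for every ray \<open>u\<close>, hence Cartier, and its degree
  two distinguishes it from the classes of the rays.
\<close>

lemma nef_partition_from_equal_columns:
  assumes \<rho>: "bij_betw \<rho> {0..<2 * s} (rays Z)"
    and weight: "\<And>u. u \<in> rays Z \<Longrightarrow> weight u = 1"
    and factors2: "\<And>i. i < length \<mu> \<Longrightarrow> \<mu> ! i = 2"
    and eq: "\<And>i j. i < length \<mu> \<Longrightarrow> j < s \<Longrightarrow>
      tor (frag_of (\<rho> j)) i = tor (frag_of (\<rho> (s + j))) i"
  shows "\<exists>P. nef_partition Z P \<and> card P = s"
proof -
  define B where "B j = {\<rho> j, \<rho> (s + j)}" for j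
  have ray: "\<rho> k \<in> rays Z" if "k < 2 * s" for k using \<rho> that by (auto simp: bij_betw_def)
  have inj: "\<rho> k = \<rho> l \<longleftrightarrow> k = l" if "k < 2 * s" "l < 2 * s" for k l
    using bij_betw_imp_inj_on[OF \<rho>] that by (simp add: inj_on_eq_iff)
  have disj: "B j \<inter> B l = {}" if "j < s" "l < s" "j \<noteq> l" for j l
    using that inj by (auto simp: B_def)
  have "inj_on B {..<s}"
  proof (rule inj_onI)
    fix j l assume "j \<in> {..<s}" "l \<in> {..<s}" "B j = B l"
    moreover have "B j \<noteq> {}" by (simp add: B_def)
    ultimately show "j = l" using disj[of j l] by auto
  qed
  then have card: "card (B ` {..<s}) = s" by (simp add: card_image)
  have part: "partition_on (rays Z) (B ` {..<s})"
  proof (rule partition_onI)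
    show "\<Union> (B ` {..<s}) = rays Z"
    proof
      show "\<Union> (B ` {..<s}) \<subseteq> rays Z" using ray by (auto simp: B_def)
      show "rays Z \<subseteq> \<Union> (B ` {..<s})"
      proof
        fix v assume "v \<in> rays Z"
        then obtain k where k: "k < 2 * s" "v = \<rho> k"
          using bij_betw_imp_surj_on[OF \<rho>] by (metis atLeastLessThan_iff imageE)
        define j where "j = (if k < s then k else k - s)"
        have "j < s" "k = j \<or> k = s + j" using k by (auto simp: j_def)
        then show "v \<in> \<Union> (B ` {..<s})" using k by (auto simp: B_def)
      qed
    qed
    show "\<And>p q. p \<in> B ` {..<s} \<Longrightarrow> q \<in> B ` {..<s} \<Longrightarrow> p \<noteq> q \<Longrightarrow> disjnt p q"
      using disj by (auto simp: disjnt_def)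
  qed (auto simp: B_def)
  have "block_class Z (B j) \<in> Pic Z \<and> (\<forall>v\<in>rays Z. block_class Z (B j) \<noteq> prime_class Z v)"
    if j: "j < s" for j
  proof -
    let ?a = "\<rho> j" and ?b = "\<rho> (s + j)"
    let ?E = "frag_of ?a + frag_of ?b"
    have ab: "?a \<in> rays Z" "?b \<in> rays Z" "?a \<noteq> ?b" using ray inj j by auto
    have keys: "Poly_Mapping.keys ?E \<subseteq> rays Z" using ab by (intro keys_add_subset) auto
    have cl: "block_class Z (B j) = div_class Z ?E"
      using block_class_eq[OF fin, of "B j"] ab by (simp add: B_def)
    have pr: "principal_div Z (?E - frag_cmul 2 (frag_of u))" if "u \<in> rays Z" for u
      using pair_class_if_equal_columns[of ?a ?b u] ab weight that factors2 eq j by simp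
    then have "cartier Z ?E" using keys cartier_iff by blast
    then have "block_class Z (B j) \<in> Pic Z" by (simp add: cl Pic_def)
    moreover have "block_class Z (B j) \<noteq> prime_class Z v" if v: "v \<in> rays Z" for v
    proof
      assume "block_class Z (B j) = prime_class Z v"
      then have "principal_div Z (?E - frag_of v)"
        by (simp add: cl prime_class_def div_class_eq_iff[OF fin])
      then have "deg ?E = deg (frag_of v)" using principal_iff[OF keys, of "frag_of v"] v by simp
      moreover have "deg ?E = weight ?a + weight ?b"
        using ab class_add[of "frag_of ?a" "frag_of ?b"]
        by (simp add: deg_def weight_def grading_group_def mult_DirProd')
      moreover have "weight ?a = 1" "weight ?b = 1" "deg (frag_of v) = 1"
        using weight ab v by (auto simp flip: weight_def)
      ultimately show False by simp
    qed
    ultimately show ?thesis by blast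
  qed
  then have "nef_partition Z (B ` {..<s})" using part by (auto simp: nef_partition_def)
  then show ?thesis using card by blast
qed

end

lemma nef_partition_from_degree_matrix:
  fixes Z :: "(real ^ 'n) set set"
  assumes complete: "complete_fan Z" and factors: "invariant_factors \<mu>"
    and dim: "CARD('n) + 1 = 2 * s" and factors2: "\<forall>i<length \<mu>. \<mu> ! i = 2"
    and Q: "degree_matrix Z \<mu> Q"
    and col: "\<forall>j<s. Q j = (1, col (length \<mu>) A j) \<and> Q (s + j) = (1, col (length \<mu>) A j)"
  shows "\<exists>P. nef_partition Z P \<and> card P = s"
proof -
  obtain \<phi> \<rho> where \<phi>: "\<phi> \<in> iso (Cl Z) (grading_group \<mu>)"
    and \<rho>': "bij_betw \<rho> {0..CARD('n)} (rays Z)"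
    and Q\<rho>': "\<forall>i\<in>{0..CARD('n)}. Q i = \<phi> (prime_class Z (\<rho> i))"
    using Q unfolding degree_matrix_def by blast
  have indices: "{0..CARD('n)} = {0..<2 * s}" using dim by auto
  note \<rho> = \<rho>'[unfolded indices] and Q\<rho> = Q\<rho>'[unfolded indices]
  interpret G: complete_fan_grading Z \<mu> \<phi> using complete factors \<phi> by unfold_locales
  have Qk: "G.weight (\<rho> k) = fst (Q k)" "G.tor (frag_of (\<rho> k)) = snd (Q k)" if "k < 2 * s" for k
    using Q\<rho> that by (simp_all add: G.weight_def G.deg_def G.tor_def prime_class_def)
  have weight: "G.weight u = 1" if u: "u \<in> rays Z" for u
  proof -
    obtain k where k: "k < 2 * s" "u = \<rho> k"
      using bij_betw_imp_surj_on[OF \<rho>] u by (metis atLeastLessThan_iff imageE)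
    define j where "j = (if k < s then k else k - s)"
    have "j < s" "k = j \<or> k = s + j" using k by (auto simp: j_def)
    then show ?thesis using k Qk(1)[of k] col by auto
  qed
  have "\<rho> 0 \<in> rays Z" using \<rho>' by (auto simp: bij_betw_def)
  then have "\<exists>u\<in>rays Z. 0 < G.weight u" using weight by fastforce
  then interpret G: positive_grading Z \<mu> \<phi> by unfold_locales
  show ?thesis
  proof (rule G.nef_partition_from_equal_columns[OF \<rho> weight])
    show "G.tor (frag_of (\<rho> j)) i = G.tor (frag_of (\<rho> (s + j))) i" if "j < s" for i j
      using that col Qk(2)[of j] Qk(2)[of "s + j"] by simp
  qed (use factors2 in auto)
qed

theorem proposition4p1:
  fixes Z :: "(real ^ 'n) set set" and \<mu> :: "nat list"
  assumes "fwps Z"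
    and "invariant_factors \<mu>"
    and "Cl Z \<cong> grading_group \<mu>"
  shows "(\<forall>P. nef_partition Z P \<longrightarrow> 2 * card P \<le> CARD('n) + 1) \<and>
         (\<forall>s. CARD('n) + 1 = 2 * s \<longrightarrow>
            ((\<exists>P. nef_partition Z P \<and> card P = s) \<longleftrightarrow>
             (\<forall>i<length \<mu>. \<mu> ! i = 2) \<and>
             (\<exists>Q A. degree_matrix Z \<mu> Q \<and> mat2 (length \<mu>) s A \<and>
                (\<forall>j<s. Q j = (1, col (length \<mu>) A j) \<and> Q (s + j) = (1, col (length \<mu>) A j)) \<and>
                affine_span2 (length \<mu>) s A =
                  carrier (product_group {..<length \<mu>} (\<lambda>i. integer_mod_group 2)))))"
proof -
  have complete: "complete_fan Z" using assms(1) by (simp add: fwps_def fano_def)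
  obtain \<phi> where "positive_grading Z \<mu> \<phi>"
    using positive_grading_exists[OF complete assms(2,3)] .
  then interpret positive_grading Z \<mu> \<phi> .
  show ?thesis
  proof (intro conjI allI impI iffI)
    fix P assume "nef_partition Z P"
    then show "2 * card P \<le> CARD('n) + 1" using nef_card_le[OF fin] card_rays_le by fastforce
  next
    fix s i assume dim: "CARD('n) + 1 = 2 * s" and i: "i < length \<mu>"
      and "\<exists>P. nef_partition Z P \<and> card P = s"
    then obtain P where P: "nef_partition Z P" "card P = s" by blast
    then have "card (rays Z) \<le> 2 * card P" using card_rays_le dim by simp
    from nef_pairs_factors[OF P(1) nef_blocks_are_pairs[OF fin P(1) this] i] show "\<mu> ! i = 2" .
  next
    fix s assume "CARD('n) + 1 = 2 * s" "\<exists>P. nef_partition Z P \<and> card P = s"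
    then show "\<exists>Q A. degree_matrix Z \<mu> Q \<and> mat2 (length \<mu>) s A \<and>
        (\<forall>j<s. Q j = (1, col (length \<mu>) A j) \<and> Q (s + j) = (1, col (length \<mu>) A j)) \<and>
        affine_span2 (length \<mu>) s A =
          carrier (product_group {..<length \<mu>} (\<lambda>i. integer_mod_group 2))"
      using nef_pairs_degree_matrix by blast
  next
    fix s
    assume dim: "CARD('n) + 1 = 2 * s" and
      R: "(\<forall>i<length \<mu>. \<mu> ! i = 2) \<and>
        (\<exists>Q A. degree_matrix Z \<mu> Q \<and> mat2 (length \<mu>) s A \<and>
          (\<forall>j<s. Q j = (1, col (length \<mu>) A j) \<and> Q (s + j) = (1, col (length \<mu>) A j)) \<and>
          affine_span2 (length \<mu>) s A =
            carrier (product_group {..<length \<mu>} (\<lambda>i. integer_mod_group 2)))"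
    from R obtain Q A where "degree_matrix Z \<mu> Q"
      "\<forall>j<s. Q j = (1, col (length \<mu>) A j) \<and> Q (s + j) = (1, col (length \<mu>) A j)" by blast
    with R show "\<exists>P. nef_partition Z P \<and> card P = s"
      using nef_partition_from_degree_matrix[OF complete assms(2) dim] by blast
  qed
qed

end
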